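(* The identity $\mathbb{T}(\mathsf{R}^{K\mathbb{P}^4})=\mathsf{R}^{[\mathbb{C}^5/\mathbb{Z}_5]}$ (with $\mathbb{T}$ applied to each coefficient of $z$ in each matrix entry) holds if and only if, for every $0\le i\le4$, the following identity of power series in $z$ holds: $$\exp\left(-\sum_{k=1}^\infty\frac{N_{2k-1}}{2k-1}\frac{B_{2k}}{2k}z^{2k-1}\right)\sum_{k=0}^\infty a^i_kz^k=\exp\left(5\sum_{k=1}^\infty(-1)^{k+1}\frac{B_{5k+1}(i/5)}{5k+1}\frac{z^{5k}}{5k}\right).$$
   Context: Let $\zeta=e^{2\pi\sqrt{-1}/5}$, let $B_{n}$ be the Bernoulli numbers and $B_n(x)$ the Bernoulli polynomials, and let $N_k=(-\frac15)^k+\sum_{i=1}^4\big(\frac1{1-\zeta^i}\big)^k$. **Basic series for $K\mathbb{P}^4$.** Let $D=q\frac{d}{dq}$ and (with $w=H/z$) $$I(q,w)=\sum_{d\ge0}q^d\frac{\prod_{k=0}^{5d-1}(-5w-k)}{\prod_{k=1}^d(w+k)^5}.$$ Put $\mathsf{F}_0=I$, $C_i(q)=\mathsf{F}_i(q,0)$, $\mathsf{F}_{i+1}=(1+w^{-1}D)(\mathsf{F}_i/C_i)$, and $L=(1+5^5q)^{-1/5}$. **Basic series for $[\mathbb{C}^5/\mathbb{Z}_5]$.** Let $D=\psi\frac{d}{d\psi}$ and $$I(\psi,z)=\sum_{a\ge0}\frac{\psi^a}{z^aa!}\prod_{0\le k<a/5,\ \langle k\rangle=\langle a/5\rangle}\big(1-(kz)^5\big)\,\phi_a,$$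 with $\phi_0,\dots,\phi_4$ basis vectors indexed mod $5$, $k$ rational, $\langle\cdot\rangle$ the fractional part. Put $\mathsf{F}_0=I$, let $C_i(\psi)$ be defined by $\mathsf{F}_i(\psi,z=\infty)=C_i\phi_i$, $\mathsf{F}_{i+1}=zD(\mathsf{F}_i/C_i)$, and $L=-\psi(1+\psi^5/5^5)^{-1/5}$. **Rings.** For $\bullet=K\mathbb{P}^4$ or $[\mathbb{C}^5/\mathbb{Z}_5]$ put $X=DC_1/C_1$, $Y=DC_2/C_2$ (with the corresponding $D$, $C_i$), and $$\mathbb{F}^\bullet=\mathbb{C}[L^{\pm1}][X,DX,D^2X,Y],$$ regarded as a polynomial ring over $\mathbb{C}[L^{\pm1}]$ in the four displayed generators; it is closed under $D$. $\mathbb{T}:\mathbb{F}^{K\mathbb{P}^4}\to\mathbb{F}^{[\mathbb{C}^5/\mathbb{Z}_5]}$ is the $\mathbb{C}$-algebra homomorphism with $$L\mapsto-\tfrac L5,\quad X\mapsto-\tfrac X5,\quad DX\mapsto\tfrac{DX}{5^2},\quad D^2X\mapsto-\tfrac{D^2X}{5^3},\quad Y\mapsto-\tfrac Y5.$$ **The system (S).** For series $R_{jp}$ ($0\le j\le4$, $p\ge0$), consider, for all $p\ge0$, $$\begin{aligned} R_{1,p+1}&=R_{0,p+1}+\tfrac{DR_{0p}}{L},\\ R_{2,p+1}&=R_{1,p+1}+\big(\tfrac{DL}{L^2}-\tfrac XL\big)R_{1p}+\tfrac{DR_{1p}}L,\\ R_{3,p+1}&=R_{2,p+1}+\big(2\tfrac{DL}{L^2}-\tfrac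 XL-\tfrac YL\big)R_{2p}+\tfrac{DR_{2p}}L,\\ R_{4,p+1}&=R_{3,p+1}+\big(\tfrac XL+\tfrac YL-2\tfrac{DL}{L^2}\big)R_{3p}+\tfrac{DR_{3p}}L,\\ R_{0,p+1}&=R_{4,p+1}+\big(\tfrac XL-\tfrac{DL}{L^2}\big)R_{4p}+\tfrac{DR_{4p}}L. \end{aligned}$$ **$\mathsf{R}^{K\mathbb{P}^4}$.** Let $R_{jp}\in\mathbb{C}[[q]]$ be the solution of (S) (with the $K\mathbb{P}^4$ series $L,X,Y$ and $D=q\frac d{dq}$) with $R_{j0}=1$ and $R_{jp}|_{q=0}=0$ for $p\ge1$. (These are the coefficients of the asymptotic expansion of the $\mathsf{T}$-equivariant genus 0 $\mathbb{S}$-operator of $K\mathbb{P}^4$ at its fixed points, with equivariant parameters $\lambda_i=\zeta^i$.) They lie in $\mathbb{F}^{K\mathbb{P}^4}$. The $\mathsf{R}$-matrix of $K\mathbb{P}^4$ is, for $0\le i,j\le4$, $$[\mathsf{R}^{K\mathbb{P}^4}(z)]_{ij}=\exp\left(-\sum_{k\ge1}\frac{N_{2k-1}}{2k-1}\frac{B_{2k}}{2k}\Big(\frac z{\zeta^i}\Big)^{2k-1}\right)\sum_{p\ge0}R_{jp}\Big(\frac z{\zeta^i}\Big)^p.$$ **$\mathsf{R}^{[\mathbb{C}^5/\mathbb{Z}_5]}$.** The (normalized) $\mathsf{R}$-matrix of $[\mathbb{C}^5/\mathbb{Z}_5]$ has entries $[\mathsf{R}^{[\mathbb{C}^5/\mathbb{Z}_5]}(z)]_{ij}=\sum_{p\ge0}P_{jp}(z/\zeta^i)^p$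 ($i$ the canonical-basis index, $j$ the index of $\phi_j$), where $P_{jp}\in\mathbb{C}[[\psi]]$ are characterized as follows: $P_{j0}=1$; the $P_{jp}$ satisfy (S) with the $[\mathbb{C}^5/\mathbb{Z}_5]$ series $L,X,Y$ and $D=\psi\frac d{d\psi}$; and $$\sum_{p\ge0}P_{jp}|_{\psi=0}\,z^p=\exp\left(5\sum_{k\ge1}(-1)^{k+1}\frac{B_{5k+1}(j/5)}{5k+1}\frac{z^{5k}}{5k}\right).$$ The $P_{jp}$ lie in $\mathbb{F}^{[\mathbb{C}^5/\mathbb{Z}_5]}$. **The numbers $a^i_k$.** For $C\in\mathbb{F}^{K\mathbb{P}^4}$ let $C^+$ be the part of $C$ of non-negative degree in $L$, and $$M(C)=C^+\big|_{L=0,\ X=-\frac15,\ Y=-\frac15,\ DX=0,\ D^2X=0}.$$ Put $a^i_k=M(R_{ik})$ for $0\le i\le4$, $k\ge0$. *)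

theory Defs
  imports
    Complex_Main
    "HOL-Computational_Algebra.Computational_Algebra"
    "HOL-Library.Poly_Mapping"
    "HOL-Library.Product_Plus"
begin

section \<open>Numbers\<close>

definition zeta :: complex where
  "zeta = exp (2 * of_real pi * \<i> / 5)"

definition bernoulli_poly :: "nat \<Rightarrow> complex \<Rightarrow> complex" where
  "bernoulli_poly n x = fact n * fps_nth (fps_X * fps_exp x / (fps_exp 1 - 1)) n"

definition bernoulli_num :: "nat \<Rightarrow> complex" where
  "bernoulli_num n = fact n * fps_nth (fps_X / (fps_exp 1 - 1)) n"

definition N_num :: "nat \<Rightarrow> complex" where
  "N_num k = (- 1 / 5) ^ k + (\<Sum>i=1..4. (1 / (1 - zeta ^ i)) ^ k)"

text \<open>The two exponential factors, as power series in \<open>z\<close>. The coefficient of \<open>z\<^sup>n\<close> in the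
  exponent is written in terms of \<open>n = 2k - 1\<close>, respectively \<open>n = 5k\<close>, with \<open>k \<ge> 1\<close>.\<close>

definition exp_K :: "complex fps" where
  "exp_K = fps_exp 1 oo
     (- Abs_fps (\<lambda>n. if odd n then N_num n / of_nat n * (bernoulli_num (n + 1) / of_nat (n + 1)) else 0))"

definition exp_O :: "nat \<Rightarrow> complex fps" where
  "exp_O j = fps_exp 1 oo
     (fps_const 5 * Abs_fps (\<lambda>n. if n \<ge> 1 \<and> 5 dvd n
        then (let k = n div 5 in
          (-1) ^ (k + 1) * (bernoulli_poly (5 * k + 1) (of_nat j / 5) / of_nat (5 * k + 1)) / of_nat (5 * k))
        else 0))"


section \<open>Series with parameters\<close>

definition coeffwise :: "('a \<Rightarrow> 'b) \<Rightarrow> 'a fps \<Rightarrow> 'b fps" where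
  "coeffwise h A = Abs_fps (\<lambda>n. h (fps_nth A n))"

text \<open>The operator \<open>q d/dq\<close> (or \<open>\<psi> d/d\<psi>\<close>) on power series with arbitrary coefficients and on
  Laurent series over the complex numbers.\<close>

definition D_fps :: "'a::comm_ring_1 fps \<Rightarrow> 'a fps" where
  "D_fps A = fps_X * fps_deriv A"

definition D :: "complex fls \<Rightarrow> complex fls" where
  "D f = fls_X * fls_deriv f"


section \<open>Basic series of \<open>KP\<^sup>4\<close>\<close>

text \<open>Power series in \<open>q\<close> over the field of Laurent series in \<open>w\<close>; the coefficients of \<open>I\<close>, which
  are rational functions of \<open>w\<close>, are expanded at \<open>w = 0\<close>. All \<open>F\<^sub>i\<close> are regular at \<open>w = 0\<close>,
  so evaluation there is the coefficient of \<open>w\<^sup>0\<close>.\<close>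

definition I_K :: "complex fls fps" where
  "I_K = Abs_fps (\<lambda>d. (\<Prod>k<5 * d. - 5 * fls_X - of_nat k) / (\<Prod>k=1..d. (fls_X + of_nat k) ^ 5))"

definition at_w0 :: "complex fls fps \<Rightarrow> complex fps" where
  "at_w0 = coeffwise (\<lambda>f. fls_nth f 0)"

primrec F_K :: "nat \<Rightarrow> complex fls fps" where
  "F_K 0 = I_K"
| "F_K (Suc i) = (let G = F_K i / coeffwise fls_const (at_w0 (F_K i))
                  in G + fps_const (inverse fls_X) * D_fps G)"

definition C_K :: "nat \<Rightarrow> complex fls" where
  "C_K i = fps_to_fls (at_w0 (F_K i))"

definition L_K :: "complex fls" where
  "L_K = fps_to_fls (fps_binomial (- 1 / 5) oo (fps_const (5 ^ 5) * fps_X))"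

definition X_K :: "complex fls" where "X_K = D (C_K 1) / C_K 1"
definition Y_K :: "complex fls" where "Y_K = D (C_K 2) / C_K 2"


section \<open>Basic series of \<open>[C\<^sup>5/Z\<^sub>5]\<close>\<close>

text \<open>Power series in \<open>\<psi>\<close> whose coefficients are Laurent series in \<open>u = 1/z\<close> (here \<open>fls_X\<close> is \<open>u\<close>);
  the coefficients occurring in \<open>F\<^sub>i\<close> have no negative powers of \<open>u\<close>, so evaluation at \<open>z = \<infinity>\<close> is
  the coefficient of \<open>u\<^sup>0\<close>. The second argument \<open>j < 5\<close> selects the component along \<open>\<phi>\<^sub>j\<close>; for
  \<open>i = 0, 1, 2, \<dots>\<close> the only nonzero component of \<open>F\<^sub>i\<close> at \<open>z = \<infinity>\<close> is the one along
  \<open>\<phi>\<^bsub>i mod 5\<^esub>\<close>. For \<open>i = 1, \<dots>, 4\<close> the series \<open>C\<^sub>i\<close> vanishes to first order at \<open>\<psi> = 0\<close>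
  and divides all components of \<open>F\<^sub>i\<close>.\<close>

definition z_O :: "complex fls" where
  "z_O = inverse fls_X"

definition I_O :: "nat \<Rightarrow> complex fls fps" where
  "I_O j = Abs_fps (\<lambda>a. if a mod 5 = j then
     1 / (z_O ^ a * fact a) *
       (\<Prod>k\<in>{k::rat. 0 \<le> k \<and> k < of_nat a / 5 \<and> frac k = frac (of_nat a / 5)}.
          1 - (of_rat k * z_O) ^ 5)
     else 0)"

definition at_infinity_O :: "complex fls fps \<Rightarrow> complex fps" where
  "at_infinity_O = coeffwise (\<lambda>f. fls_nth f 0)"

primrec F_O :: "nat \<Rightarrow> nat \<Rightarrow> complex fls fps" where
  "F_O 0 = I_O"
| "F_O (Suc i) = (\<lambda>j. fps_const z_O *
      D_fps (F_O i j / coeffwise fls_const (at_infinity_O (F_O i (i mod 5)))))"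

definition C_O :: "nat \<Rightarrow> complex fls" where
  "C_O i = fps_to_fls (at_infinity_O (F_O i (i mod 5)))"

definition L_O :: "complex fls" where
  "L_O = - fls_X * fps_to_fls (fps_binomial (- 1 / 5) oo (fps_const (1 / 5 ^ 5) * fps_X ^ 5))"

definition X_O :: "complex fls" where "X_O = D (C_O 1) / C_O 1"
definition Y_O :: "complex fls" where "Y_O = D (C_O 2) / C_O 2"


section \<open>The rings and the homomorphism\<close>

text \<open>The ring \<open>\<complex>[L\<^sup>\<plusminus>][X, DX, D\<^sup>2X, Y]\<close> as the monoid algebra of \<open>\<int> \<times> \<nat>\<^sup>4\<close>:
  the exponent \<open>(a, b, c, d, e)\<close> stands for \<open>L\<^sup>a X\<^sup>b (DX)\<^sup>c (D\<^sup>2X)\<^sup>d Y\<^sup>e\<close>.\<close>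

type_synonym FF = "(int \<times> nat \<times> nat \<times> nat \<times> nat) \<Rightarrow>\<^sub>0 complex"

definition subst_FF :: "(complex \<Rightarrow> 'a) \<Rightarrow> 'a \<Rightarrow> 'a \<Rightarrow> 'a \<Rightarrow> 'a \<Rightarrow> 'a \<Rightarrow> FF \<Rightarrow> 'a::field" where
  "subst_FF \<iota> l x0 x1 x2 y f =
     (\<Sum>(a, b, c, d, e)\<in>Poly_Mapping.keys f. \<iota> (Poly_Mapping.lookup f (a, b, c, d, e)) *
        l powi a * x0 ^ b * x1 ^ c * x2 ^ d * y ^ e)"

definition ev_K :: "FF \<Rightarrow> complex fls" where
  "ev_K = subst_FF fls_const L_K X_K (D X_K) (D (D X_K)) Y_K"

definition ev_O :: "FF \<Rightarrow> complex fls" where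
  "ev_O = subst_FF fls_const L_O X_O (D X_O) (D (D X_O)) Y_O"

definition ring_K :: "complex fls set" where
  "ring_K = range ev_K"

text \<open>That \<open>ring_K\<close> is a polynomial ring over \<open>\<complex>[L\<^sup>\<plusminus>]\<close> in the four generators is expressed by
  \<open>inj ev_K\<close>. Then \<open>inv ev_K\<close> gives the polynomial expression of an element of \<open>ring_K\<close>, through
  which both \<open>T\<close> and \<open>M\<close> are defined.\<close>

definition T_FF :: "FF \<Rightarrow> FF" where
  "T_FF = Poly_Mapping.mapp (\<lambda>(a, b, c, d, e) v.
     v * (- 1 / 5) powi a * (- 1 / 5) ^ b * (1 / 5 ^ 2) ^ c * (- 1 / 5 ^ 3) ^ d * (- 1 / 5) ^ e)"

definition T :: "complex fls \<Rightarrow> complex fls" where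
  "T s = ev_O (T_FF (inv ev_K s))"

definition plus_part :: "FF \<Rightarrow> FF" where
  "plus_part = Poly_Mapping.mapp (\<lambda>(a, b, c, d, e) v. if a \<ge> 0 then v else 0)"

definition M :: "complex fls \<Rightarrow> complex" where
  "M s = subst_FF id 0 (- 1 / 5) 0 0 (- 1 / 5) (plus_part (inv ev_K s))"


section \<open>The system of equations and the \<open>R\<close>-matrices\<close>

definition system_S ::
  "complex fls \<Rightarrow> complex fls \<Rightarrow> complex fls \<Rightarrow> (nat \<Rightarrow> nat \<Rightarrow> complex fls) \<Rightarrow> bool" where
  "system_S L X Y R \<longleftrightarrow> (\<forall>p.
     R 1 (p + 1) = R 0 (p + 1) + D (R 0 p) / L \<and>
     R 2 (p + 1) = R 1 (p + 1) + (D L / L ^ 2 - X / L) * R 1 p + D (R 1 p) / L \<and>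
     R 3 (p + 1) = R 2 (p + 1) + (2 * (D L / L ^ 2) - X / L - Y / L) * R 2 p + D (R 2 p) / L \<and>
     R 4 (p + 1) = R 3 (p + 1) + (X / L + Y / L - 2 * (D L / L ^ 2)) * R 3 p + D (R 3 p) / L \<and>
     R 0 (p + 1) = R 4 (p + 1) + (X / L - D L / L ^ 2) * R 4 p + D (R 4 p) / L)"

definition R_solution_K :: "(nat \<Rightarrow> nat \<Rightarrow> complex fps) \<Rightarrow> bool" where
  "R_solution_K R \<longleftrightarrow>
     system_S L_K X_K Y_K (\<lambda>j p. fps_to_fls (R j p)) \<and>
     (\<forall>j\<le>4. R j 0 = 1) \<and> (\<forall>j\<le>4. \<forall>p\<ge>1. fps_nth (R j p) 0 = 0)"

definition R_solution_O :: "(nat \<Rightarrow> nat \<Rightarrow> complex fps) \<Rightarrow> bool" where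
  "R_solution_O P \<longleftrightarrow>
     system_S L_O X_O Y_O (\<lambda>j p. fps_to_fls (P j p)) \<and>
     (\<forall>j\<le>4. P j 0 = 1) \<and> (\<forall>j\<le>4. Abs_fps (\<lambda>p. fps_nth (P j p) 0) = exp_O j)"

text \<open>Matrix entries are power series in \<open>z\<close> over Laurent series in \<open>q\<close>, respectively \<open>\<psi>\<close>.\<close>

definition rescale :: "nat \<Rightarrow> complex fls fps \<Rightarrow> complex fls fps" where
  "rescale i A = A oo (fps_const (fls_const (1 / zeta ^ i)) * fps_X)"

definition Rmat_K :: "(nat \<Rightarrow> nat \<Rightarrow> complex fps) \<Rightarrow> nat \<Rightarrow> nat \<Rightarrow> complex fls fps" where
  "Rmat_K R i j =
     rescale i (coeffwise fls_const exp_K) * rescale i (Abs_fps (\<lambda>p. fps_to_fls (R j p)))"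

definition Rmat_O :: "(nat \<Rightarrow> nat \<Rightarrow> complex fps) \<Rightarrow> nat \<Rightarrow> nat \<Rightarrow> complex fls fps" where
  "Rmat_O P i j = rescale i (Abs_fps (\<lambda>p. fps_to_fls (P j p)))"

definition a_num :: "(nat \<Rightarrow> nat \<Rightarrow> complex fps) \<Rightarrow> nat \<Rightarrow> nat \<Rightarrow> complex" where
  "a_num R i k = M (fps_to_fls (R i k))"

end

theory Submission
  imports Defs
begin

text \<open>
  Put \<open>\<theta> = 5 D\<close> for \<open>KP\<^sup>4\<close> and \<open>\<theta> = - D\<close> for the orbifold. On both sides \<open>u = C\<^sub>1\<close> satisfies the
  same equation \<open>L\<^sup>5 \<theta>\<^sup>4 u + (1 - L\<^sup>5) (\<theta> + 1) (\<theta> + 2) (\<theta> + 3) (\<theta> + 4) u = 0\<close> (with \<open>-L/5\<close> in place of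
  \<open>L\<close> for the orbifold). It expresses \<open>D\<^sup>3X\<close> in the ring; because the operator is self-adjoint, it
  also yields a second order equation for \<open>C\<^sub>2\<close>, which expresses \<open>DY\<close>. As the relations agree, \<open>T\<close>
  intertwines the two \<open>\<theta>\<close> and maps \<open>R\<close> to a solution of the orbifold system. Solutions with the same
  first terms are determined by their values at \<open>\<psi> = 0\<close>, so it remains to see that \<open>T(R\<^sub>j\<^sub>p)\<close> at
  \<open>\<psi> = 0\<close> is \<open>M(R\<^sub>j\<^sub>p)\<close>, although \<open>M\<close> drops the negative powers of \<open>L\<close>. This holds for elements of
  non-negative weight in a filtration in which \<open>L\<close> has weight 1 and \<open>\<theta>\<close> acts as \<open>-w\<close> on weight \<open>w\<close>,
  up to higher weight. An element whose \<open>\<theta>\<close>-derivative has non-negative weight then has non-negative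
  weight itself, and the system gives this for all \<open>R\<^sub>j\<^sub>p\<close> by induction on \<open>p\<close>.
\<close>

section \<open>The monoid algebra and its evaluations\<close>

fun mono_val :: "complex fls \<Rightarrow> complex fls \<Rightarrow> complex fls \<Rightarrow> complex fls \<Rightarrow> complex fls \<Rightarrow>
    int \<times> nat \<times> nat \<times> nat \<times> nat \<Rightarrow> complex fls" where
  "mono_val l x0 x1 x2 y (a, b, c, d, e) = l powi a * x0 ^ b * x1 ^ c * x2 ^ d * y ^ e"

lemma mono_val_add:
  assumes "l \<noteq> 0"
  shows "mono_val l x0 x1 x2 y (m + n) = mono_val l x0 x1 x2 y m * mono_val l x0 x1 x2 y n"
  using assms by (cases m; cases n) (simp add: power_int_add power_add mult_ac)

lemma subst_FF_eq_sum:
  assumes "finite A" "Poly_Mapping.keys f \<subseteq> A"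
  shows "subst_FF fls_const l x0 x1 x2 y f =
    (\<Sum>m\<in>A. fls_const (Poly_Mapping.lookup f m) * mono_val l x0 x1 x2 y m)"
proof -
  have "subst_FF fls_const l x0 x1 x2 y f =
    (\<Sum>m\<in>Poly_Mapping.keys f. fls_const (Poly_Mapping.lookup f m) * mono_val l x0 x1 x2 y m)"
    unfolding subst_FF_def by (intro sum.cong refl) (auto simp: mult.assoc)
  also have "\<dots> = (\<Sum>m\<in>A. fls_const (Poly_Mapping.lookup f m) * mono_val l x0 x1 x2 y m)"
    using assms by (intro sum.mono_neutral_left) (auto simp: in_keys_iff)
  finally show ?thesis .
qed

lemma subst_FF_single:
  "subst_FF fls_const l x0 x1 x2 y (Poly_Mapping.single m c) = fls_const c * mono_val l x0 x1 x2 y m"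
  by (subst subst_FF_eq_sum[of "{m}"]) auto

lemma subst_FF_add:
  "subst_FF fls_const l x0 x1 x2 y (f + g) =
     subst_FF fls_const l x0 x1 x2 y f + subst_FF fls_const l x0 x1 x2 y g"
proof -
  let ?A = "Poly_Mapping.keys f \<union> Poly_Mapping.keys g"
  have "Poly_Mapping.keys (f + g) \<subseteq> ?A"
    by (rule Poly_Mapping.keys_add)
  then show ?thesis
    by (simp add: subst_FF_eq_sum[of ?A] lookup_add sum.distrib[symmetric] distrib_right
        fls_plus_const[symmetric])
qed

lemma FF_induct_add [case_names single add]:
  fixes f :: FF
  assumes single: "\<And>m c. Q (Poly_Mapping.single m c)"
    and add: "\<And>f g. Q f \<Longrightarrow> Q g \<Longrightarrow> Q (f + g)"
  shows "Q f"
proof (induction f rule: update_induct)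
  case const
  then show ?case using single[of 0 0] by simp
next
  case (update f a b)
  then have "Poly_Mapping.update a b f = f + Poly_Mapping.single a b"
    by (intro poly_mapping_eqI) (auto simp: lookup_update lookup_add lookup_single in_keys_iff)
  then show ?case using update single add by simp
qed

lemma subst_FF_mult:
  assumes "l \<noteq> 0"
  shows "subst_FF fls_const l x0 x1 x2 y (f * g) =
     subst_FF fls_const l x0 x1 x2 y f * subst_FF fls_const l x0 x1 x2 y g"
proof (induction f rule: FF_induct_add)
  case (single m c)
  show ?case
  proof (induction g rule: FF_induct_add)
    case (single n d)
    then show ?case
      using assms by (simp add: mult_single subst_FF_single mono_val_add mult_ac)
  next
    case (add f g)
    then show ?case by (simp add: distrib_left subst_FF_add)
  qed
next
  case (add f g)
  then show ?case by (simp add: distrib_right subst_FF_add)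
qed

section \<open>Generators of the ring and induction over them\<close>

abbreviation cc :: "complex \<Rightarrow> FF" where "cc c \<equiv> Poly_Mapping.single 0 c"

definition "vL = (Poly_Mapping.single (1, 0, 0, 0, 0) 1 :: FF)"
definition "vL' = (Poly_Mapping.single (-1, 0, 0, 0, 0) 1 :: FF)"
definition "vX = (Poly_Mapping.single (0, 1, 0, 0, 0) 1 :: FF)"
definition "vX1 = (Poly_Mapping.single (0, 0, 1, 0, 0) 1 :: FF)"
definition "vX2 = (Poly_Mapping.single (0, 0, 0, 1, 0) 1 :: FF)"
definition "vY = (Poly_Mapping.single (0, 0, 0, 0, 1) 1 :: FF)"

lemmas var_defs = vL_def vL'_def vX_def vX1_def vX2_def vY_def

lemma subst_FF_const: "subst_FF fls_const l x0 x1 x2 y (cc c) = fls_const c"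
  by (simp add: subst_FF_single zero_prod_def)

lemma subst_FF_vars:
  "subst_FF fls_const l x0 x1 x2 y vL = l"
  "subst_FF fls_const l x0 x1 x2 y vL' = inverse l"
  "subst_FF fls_const l x0 x1 x2 y vX = x0"
  "subst_FF fls_const l x0 x1 x2 y vX1 = x1"
  "subst_FF fls_const l x0 x1 x2 y vX2 = x2"
  "subst_FF fls_const l x0 x1 x2 y vY = y"
  by (simp_all add: var_defs subst_FF_single power_int_minus)

lemma subst_FF_0: "subst_FF fls_const l x0 x1 x2 y 0 = 0"
  using subst_FF_const[of l x0 x1 x2 y 0] by simp

lemma subst_FF_uminus: "subst_FF fls_const l x0 x1 x2 y (- f) = - subst_FF fls_const l x0 x1 x2 y f"
  using subst_FF_add[of l x0 x1 x2 y f "- f"] by (simp add: subst_FF_0 add_eq_0_iff)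

lemma subst_FF_diff: "subst_FF fls_const l x0 x1 x2 y (f - g) =
    subst_FF fls_const l x0 x1 x2 y f - subst_FF fls_const l x0 x1 x2 y g"
  by (metis diff_conv_add_uminus subst_FF_add subst_FF_uminus)

lemma subst_FF_1: "subst_FF fls_const l x0 x1 x2 y 1 = 1"
  using subst_FF_const[of l x0 x1 x2 y 1] by simp

lemma subst_FF_numeral: "subst_FF fls_const l x0 x1 x2 y (numeral n) = numeral n"
  using subst_FF_const[of l x0 x1 x2 y "numeral n"] by simp

lemma subst_FF_power:
  assumes "l \<noteq> 0"
  shows "subst_FF fls_const l x0 x1 x2 y (f ^ n) = subst_FF fls_const l x0 x1 x2 y f ^ n"
  by (induction n) (simp_all add: subst_FF_1 subst_FF_mult assms)

lemmas subst_FF_hom = subst_FF_add subst_FF_mult subst_FF_diff subst_FF_uminus subst_FF_0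
  subst_FF_1 subst_FF_numeral subst_FF_power subst_FF_const subst_FF_vars

lemma vL_vL': "vL * vL' = 1"
  by (simp add: var_defs mult_single flip: single_one zero_prod_def)

lemma vX_power: "vX ^ n = Poly_Mapping.single (0, n, 0, 0, 0) 1"
  by (induction n) (simp_all add: vX_def mult_single flip: single_one zero_prod_def)

lemma vX1_power: "vX1 ^ n = Poly_Mapping.single (0, 0, n, 0, 0) 1"
  by (induction n) (simp_all add: vX1_def mult_single flip: single_one zero_prod_def)

lemma vX2_power: "vX2 ^ n = Poly_Mapping.single (0, 0, 0, n, 0) 1"
  by (induction n) (simp_all add: vX2_def mult_single flip: single_one zero_prod_def)

lemma vY_power: "vY ^ n = Poly_Mapping.single (0, 0, 0, 0, n) 1"
  by (induction n) (simp_all add: vY_def mult_single flip: single_one zero_prod_def)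

lemma vL_power: "vL ^ n = Poly_Mapping.single (int n, 0, 0, 0, 0) 1"
  by (induction n) (simp_all add: vL_def mult_single flip: single_one zero_prod_def)

lemma vL'_power: "vL' ^ n = Poly_Mapping.single (- int n, 0, 0, 0, 0) 1"
  by (induction n) (simp_all add: vL'_def mult_single flip: single_one zero_prod_def)

text \<open>Negative powers of \<open>L\<close> are powers of \<open>vL'\<close>, so every monomial
  is a constant times a product of the six generators; claims stable under sums and products need
  only be checked on these.\<close>

lemma FF_induct [case_names const L L' X X1 X2 Y add mult]:
  fixes f :: FF
  assumes const: "\<And>c. Q (cc c)"
    and gens: "Q vL" "Q vL'" "Q vX" "Q vX1" "Q vX2" "Q vY"
    and add: "\<And>f g. Q f \<Longrightarrow> Q g \<Longrightarrow> Q (f + g)"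
    and mult: "\<And>f g. Q f \<Longrightarrow> Q g \<Longrightarrow> Q (f * g)"
  shows "Q f"
proof (induction f rule: FF_induct_add)
  case (single m v)
  obtain a b c d e where m: "m = (a, b, c, d, e)" by (cases m)
  have one: "Q 1" using const[of 1] by simp
  have pow: "Q (g ^ n)" if "Q g" for g n
    by (induction n) (auto intro: one mult that)
  let ?La = "if a \<ge> 0 then vL ^ nat a else vL' ^ nat (- a)"
  have "?La = Poly_Mapping.single (a, 0, 0, 0, 0) 1"
    by (auto simp: vL_power vL'_power)
  then have "Poly_Mapping.single m v = cc v * (?La * (vX ^ b * (vX1 ^ c * (vX2 ^ d * vY ^ e))))"
    by (simp only: vX_power vX1_power vX2_power vY_power m mult_single) (simp add: zero_prod_def)
  moreover have "Q \<dots>"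
    by (intro mult const) (auto intro: pow gens)
  ultimately show ?case by simp
next
  case (add f g)
  then show ?case by (rule assms(8))
qed

lemma ev_K_eq: "ev_K = subst_FF fls_const L_K X_K (D X_K) (D (D X_K)) Y_K"
  by (simp add: ev_K_def)

text \<open>\<open>ev_O \<circ> T_FF\<close>: the generators \<open>L\<close>, \<open>X\<close>, \<open>Y\<close> are rescaled by \<open>-1/5\<close> and each \<open>D\<close> becomes \<open>-D/5\<close>.\<close>

definition ev_T :: "FF \<Rightarrow> complex fls" where
  "ev_T = subst_FF fls_const (- L_O / 5) (- X_O / 5) (D X_O / 25) (- D (D X_O) / 125) (- Y_O / 5)"

lemma fls_divide_numeral: "f / numeral n = fls_const (1 / numeral n) * (f :: complex fls)"
proof -
  have "fls_const (1 / numeral n) * (numeral n :: complex fls) = 1"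
    by (simp flip: fls_const_numeral)
  then show ?thesis
    by (simp add: field_simps)
qed

text \<open>The scalar that \<open>T_FF\<close> attaches to a monomial is a product of powers and
  can be absorbed into the values substituted for the generators.\<close>

lemma ev_O_T_FF: "ev_O (T_FF f) = ev_T f"
proof -
  let ?h = "\<lambda>(a, b, c, d, e) v. v * (- 1 / 5) powi a * (- 1 / 5) ^ b * (1 / 5 ^ 2) ^ c
      * (- 1 / 5 ^ 3) ^ d * (- 1 / 5 :: complex) ^ e"
  have "Poly_Mapping.keys (T_FF f) \<subseteq> Poly_Mapping.keys f"
    unfolding T_FF_def by (rule keys_mapp_subset)
  then have "ev_O (T_FF f) = (\<Sum>m\<in>Poly_Mapping.keys f. fls_const (Poly_Mapping.lookup (T_FF f) m)
      * mono_val L_O X_O (D X_O) (D (D X_O)) Y_O m)"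
    by (simp add: ev_O_def subst_FF_eq_sum[of "Poly_Mapping.keys f"])
  also have "\<dots> = (\<Sum>m\<in>Poly_Mapping.keys f. fls_const (Poly_Mapping.lookup f m)
      * mono_val (- L_O / 5) (- X_O / 5) (D X_O / 25) (- D (D X_O) / 125) (- Y_O / 5) m)"
  proof (intro sum.cong refl)
    fix m assume m: "m \<in> Poly_Mapping.keys f"
    obtain a b c d e where mm: "m = (a, b, c, d, e)" by (cases m)
    have "(- L_O / 5) = fls_const (-1/5) * L_O" "(- X_O / 5) = fls_const (-1/5) * X_O"
      "D X_O / 25 = fls_const (1/5^2) * D X_O" "(- D (D X_O) / 125) = fls_const (-1/5^3) * D (D X_O)"
      "(- Y_O / 5) = fls_const (-1/5) * Y_O"
      by (simp_all add: fls_divide_numeral)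
    note e = this
    show "fls_const (Poly_Mapping.lookup (T_FF f) m) * mono_val L_O X_O (D X_O) (D (D X_O)) Y_O m
      = fls_const (Poly_Mapping.lookup f m)
      * mono_val (- L_O / 5) (- X_O / 5) (D X_O / 25) (- D (D X_O) / 125) (- Y_O / 5) m"
      unfolding e mm mono_val.simps power_int_mult_distrib power_mult_distrib
        fls_const_power[symmetric] fls_const_power_int[symmetric]
      using m unfolding mm T_FF_def lookup_mapp
      by (simp add: fls_const_mult_const[symmetric] mult_ac del: fls_const_mult_const)
  qed
  also have "\<dots> = ev_T f"
    by (simp add: ev_T_def subst_FF_eq_sum[of "Poly_Mapping.keys f"])
  finally show ?thesis .
qed

text \<open>The constant \<open>1/5\<close> in the value at \<open>L\<close> does not affect the coefficient of \<open>X\<^sup>0\<close>; it is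
  chosen to match the leading coefficient of \<open>- L_O / 5\<close>.\<close>

definition ev_p :: "FF \<Rightarrow> complex fls" where
  "ev_p = subst_FF fls_const (fls_X / 5) (- 1 / 5) 0 0 (- 1 / 5)"

text \<open>Injectivity recovers \<open>f\<close> from its value. Dropping negative powers and then
  setting \<open>L = 0\<close> keeps the monomials of exponent 0 in \<open>L\<close>; under
  \<open>ev_p\<close> a monomial becomes a multiple of \<open>fls_X powi a\<close>, so the
  coefficient of index 0 selects the same ones.\<close>

lemma M_conv_ev_p:
  assumes "inj ev_K"
  shows "M (ev_K f) = fls_nth (ev_p f) 0"
proof -
  have inv: "inv ev_K (ev_K f) = f"
    using assms by simp
  let ?A = "Poly_Mapping.keys f"
  have K: "Poly_Mapping.keys (plus_part f) \<subseteq> ?A"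
    unfolding plus_part_def by (rule keys_mapp_subset)
  define g where "g = (\<lambda>(a, b, c, d, e). Poly_Mapping.lookup f (a, b, c, d, e) *
        (if a = 0 then 1 else 0) * (- 1 / 5) ^ b * 0 ^ c * 0 ^ d * (- 1 / 5 :: complex) ^ e)"
  have "M (ev_K f) = (\<Sum>(a, b, c, d, e)\<in>Poly_Mapping.keys (plus_part f).
      Poly_Mapping.lookup (plus_part f) (a, b, c, d, e) *
        0 powi a * (- 1 / 5) ^ b * 0 ^ c * 0 ^ d * (- 1 / 5) ^ e)"
    by (simp add: M_def inv subst_FF_def)
  also have "\<dots> = (\<Sum>(a, b, c, d, e)\<in>?A.
      Poly_Mapping.lookup (plus_part f) (a, b, c, d, e) *
        0 powi a * (- 1 / 5) ^ b * 0 ^ c * 0 ^ d * (- 1 / 5) ^ e)"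
    using K by (intro sum.mono_neutral_left) (auto simp: in_keys_iff)
  also have "\<dots> = (\<Sum>m\<in>?A. g m)"
    by (intro sum.cong refl) (auto simp: g_def plus_part_def lookup_mapp power_int_0_left_if)
  also have "\<dots> = (\<Sum>m\<in>?A. fls_nth (fls_const (Poly_Mapping.lookup f m) *
      mono_val (fls_X / 5) (- 1 / 5) 0 0 (- 1 / 5) m) 0)"
  proof (intro sum.cong refl)
    fix m assume "m \<in> ?A"
    obtain a b c d e where mm: "m = (a, b, c, d, e)" by (cases m)
    have e: "fls_X / 5 = fls_const (1 / 5 :: complex) * fls_X" "- 1 / 5 = fls_const (- 1 / 5 :: complex)"
      by (rule fls_divide_numeral) (use fls_divide_numeral[of "-1"] in simp)
    have z: "0 ^ n = (fls_const (0 ^ n) :: complex fls)" for n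
      by (cases n) auto
    have X: "fls_nth (fls_X powi a :: complex fls) 0 = (if a = 0 then 1 else 0)"
      by simp
    let ?K = "Poly_Mapping.lookup f m * (1 / 5) powi a * (- 1 / 5) ^ b * 0 ^ c * 0 ^ d * (- 1 / 5 :: complex) ^ e"
    have "fls_const (Poly_Mapping.lookup f m) * mono_val (fls_X / 5) (- 1 / 5) 0 0 (- 1 / 5) m =
        fls_const ?K * fls_X powi a"
      unfolding mm mono_val.simps e z power_int_mult_distrib
        fls_const_power[symmetric] fls_const_power_int[symmetric]
      by (simp only: fls_const_mult_const[symmetric] mult_ac)
    then show "g m = fls_nth (fls_const (Poly_Mapping.lookup f m) *
      mono_val (fls_X / 5) (- 1 / 5) 0 0 (- 1 / 5) m) 0"
      by (simp add: mm g_def X mult_ac)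
  qed
  also have "\<dots> = fls_nth (ev_p f) 0"
    by (simp add: ev_p_def subst_FF_eq_sum[of ?A] fls_nth_sum)
  finally show ?thesis .
qed

section \<open>Differential relations\<close>

text \<open>The relations are derived once for an abstract derivation and then used for
  \<open>5 * D\<close> on the side of \<open>KP^4\<close> and for \<open>- D\<close> on the orbifold
  side.\<close>

locale derivation =
  fixes d :: "'a::idom \<Rightarrow> 'a"
  assumes d_add: "d (x + y) = d x + d y"
    and d_mult: "d (x * y) = d x * y + x * d y"
begin

lemma d_0: "d 0 = 0"
proof -
  have "d 0 = d 0 + d 0"
    using d_add[of 0 0] by (simp only: add_0)
  then show ?thesis by (rule iffD1[OF add_cancel_right_right])
qed

lemma d_uminus: "d (- x) = - d x"
  using d_add[of x "- x"] by (simp add: d_0 add_eq_0_iff)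

lemma d_diff: "d (x - y) = d x - d y"
  using d_add[of x "- y"] by (simp add: d_uminus)

lemma d_1: "d 1 = 0"
proof -
  have "d 1 = d 1 + d 1"
    using d_mult[of 1 1] by (simp only: mult_1 mult_1_right)
  then show ?thesis by (rule iffD1[OF add_cancel_right_right])
qed

lemma d_of_nat: "d (of_nat n) = 0"
  by (induction n) (simp_all add: d_0 d_1 d_add)

lemma d_numeral: "d (numeral n) = 0"
  by (metis d_of_nat of_nat_numeral)

lemma d_power: "d (x ^ Suc n) = of_nat (Suc n) * x ^ n * d x"
  by (induction n) (simp_all add: d_mult algebra_simps)

lemmas d_simps = d_0 d_1 d_numeral d_add d_diff d_uminus d_mult

lemma d_power5:
  assumes "d l = l * (l ^ 5 - 1)"
  shows "d (l ^ 5) = 5 * l ^ 5 * (l ^ 5 - 1)"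
proof -
  have "d (l ^ 5) = 5 * l ^ 4 * d l"
    using d_power[of l 4] by simp
  also have "\<dots> = 5 * (l ^ 4 * l) * (l ^ 5 - 1)"
    by (simp add: assms)
  also have "l ^ 4 * l = l ^ 5"
    by (simp flip: power_Suc2)
  finally show ?thesis .
qed

text \<open>Here \<open>L\<close> is the fifth power of the series called \<open>L\<close>
  elsewhere. The operator is \<open>L d^4 + (1 - L) (d + 1) (d + 2) (d + 3) (d + 4)\<close> with the
  fourth order terms collected.\<close>

definition L_op :: "'a \<Rightarrow> 'a \<Rightarrow> 'a" where
  "L_op L u = d (d (d (d u))) + (1 - L) * (10 * d (d (d u)) + 35 * d (d u) + 50 * d u + 24 * u)"

text \<open>The formal derivative of \<open>L_op\<close> in \<open>d\<close>: the part linear in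
  \<open>e\<close> when \<open>d\<close> is replaced by \<open>d + e\<close>.\<close>

definition L_op' :: "'a \<Rightarrow> 'a \<Rightarrow> 'a" where
  "L_op' L u = 4 * d (d (d u)) + (1 - L) * (30 * d (d u) + 70 * d u + 50 * u)"

text \<open>In terms of \<open>W = u v' - u' v = u\<^sup>2 t\<close> with \<open>v = u \<integral>t\<close> this is
  \<open>(u v''' - u''' v) - (u' v'' - u'' v') + 5 (1 - L) W' + 10 (1 - L) W\<close>, the bilinear form that is
  preserved by the flow because the fourth order operator is self-adjoint.\<close>

definition S_form :: "'a \<Rightarrow> 'a \<Rightarrow> 'a \<Rightarrow> 'a" where
  "S_form L u t = - 2 * d u * d u * t + 4 * u * d (d u) * t + 2 * u * d u * d t + u * u * d (d t)
     + 5 * (1 - L) * (2 * u * d u * t + u * u * d t) + 10 * (1 - L) * u * u * t"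

text \<open>Subtracting \<open>r\<close> times the equation of \<open>u\<close> leaves a third order
  equation for \<open>t = k + d r\<close> alone, and \<open>u\<close> times it is
  \<open>d S + 5 (1 - L) S\<close>. The case \<open>k = 5\<close> comes from the expansion in
  \<open>w\<close> for \<open>KP^4\<close>; for \<open>k = 0\<close>, \<open>u r\<close> is a second
  solution.\<close>

lemma d_S_form:
  assumes dL: "d L = 5 * L * (L - 1)"
    and u: "L_op L u = 0" and g: "L_op L (u * r) + k * L_op' L u = 0" and k: "d k = 0"
  shows "d (S_form L u (k + d r)) = - 5 * (1 - L) * S_form L u (k + d r)"
proof -
  define u1 where "u1 = d u"
  define u2 where "u2 = d u1"
  define u3 where "u3 = d u2"
  define u4 where "u4 = d u3"
  define t where "t = k + d r"
  define t1 where "t1 = d t"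
  define t2 where "t2 = d t1"
  define t3 where "t3 = d t2"
  have du: "d u = u1" "d u1 = u2" "d u2 = u3" "d u3 = u4"
    by (simp_all add: u1_def u2_def u3_def u4_def)
  have dt: "d t = t1" "d t1 = t2" "d t2 = t3"
    by (simp_all add: t1_def t2_def t3_def)
  have dr: "d r = t - k"
    by (simp add: t_def)
  have "u * t3 + 4 * u1 * t2 + 6 * u2 * t1 + 4 * u3 * t + (1 - L) * (10 * (u * t2 + 3 * u1 * t1 + 3 * u2 * t)
      + 35 * (u * t1 + 2 * u1 * t) + 50 * u * t) = L_op L (u * r) + k * L_op' L u - r * L_op L u"
    unfolding L_op_def L_op'_def by (simp add: d_simps du dt dr k algebra_simps)
  then have E: "u * t3 + 4 * u1 * t2 + 6 * u2 * t1 + 4 * u3 * t + (1 - L) * (10 * (u * t2 + 3 * u1 * t1 + 3 * u2 * t)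
      + 35 * (u * t1 + 2 * u1 * t) + 50 * u * t) = 0"
    by (simp add: u g)
  have "d (S_form L u t) + 5 * (1 - L) * S_form L u t = u * (u * t3 + 4 * u1 * t2 + 6 * u2 * t1 + 4 * u3 * t + (1 - L) * (10 * (u * t2 + 3 * u1 * t1 + 3 * u2 * t)
      + 35 * (u * t1 + 2 * u1 * t) + 50 * u * t))"
    unfolding S_form_def by (simp add: d_simps du dt dL algebra_simps)
  then show ?thesis
    unfolding E t_def[symmetric] by (simp add: algebra_simps add_eq_0_iff)
qed

text \<open>Division of \<open>S_form\<close> by \<open>u^2 t\<close> leaves a Riccati equation for
  the logarithmic derivative \<open>y\<close>.\<close>

lemma relation_y:
  assumes S: "S_form L u t = 0" and x: "d u = x * u" and y: "d t = y * t" and nz: "u \<noteq> 0" "t \<noteq> 0"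
  shows "d y = - 4 * d x - 2 * x * x - 2 * x * y - y * y - 5 * (1 - L) * (2 * x + y + 2)"
proof -
  have "u * u * t * (d y + 4 * d x + 2 * x * x + 2 * x * y + y * y + 5 * (1 - L) * (2 * x + y + 2))
    = S_form L u t"
    unfolding S_form_def by (simp add: d_simps x y algebra_simps)
  then have "d y + 4 * d x + 2 * x * x + 2 * x * y + y * y + 5 * (1 - L) * (2 * x + y + 2) = 0"
    using S nz by simp
  then show ?thesis
    by algebra
qed

lemma relation_x:
  assumes u: "L_op L u = 0" and x: "d u = x * u" and nz: "u \<noteq> 0"
  shows "d (d (d x)) = - (4 * x * d (d x) + 3 * d x * d x + 6 * x * x * d x + x ^ 4)
    - (1 - L) * (10 * (d (d x) + 3 * x * d x + x ^ 3) + 35 * (d x + x * x) + 50 * x + 24)"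
proof -
  have "u * (d (d (d x)) + (4 * x * d (d x) + 3 * d x * d x + 6 * x * x * d x + x ^ 4)
    + (1 - L) * (10 * (d (d x) + 3 * x * d x + x ^ 3) + 35 * (d x + x * x) + 50 * x + 24)) = L_op L u"
    unfolding L_op_def by (simp add: d_simps x algebra_simps eval_nat_numeral)
  then have "d (d (d x)) + (4 * x * d (d x) + 3 * d x * d x + 6 * x * x * d x + x ^ 4)
    + (1 - L) * (10 * (d (d x) + 3 * x * d x + x ^ 3) + 35 * (d x + x * x) + 50 * x + 24) = 0"
    using u nz by simp
  then show ?thesis
    by algebra
qed

end

lemma D_nth [simp]: "fls_nth (D f) n = of_int n * fls_nth f n"
  by (simp add: D_def fls_X_times_conv_shift)

lemma D_add: "D (f + g) = D f + D g"
  by (simp add: D_def algebra_simps)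

lemma D_mult: "D (f * g) = D f * g + f * D g"
  by (simp add: D_def algebra_simps)

interpretation D: derivation D
  by unfold_locales (rule D_add D_mult)+

interpretation D5: derivation "\<lambda>f. 5 * D f"
  by unfold_locales (simp_all add: D_add D_mult algebra_simps)

interpretation Dm: derivation "\<lambda>f. - D f"
  by unfold_locales (simp_all add: D_add D_mult algebra_simps)

lemma D_const: "D (fls_const c) = 0"
  by (simp add: D_def)

lemma D_fls_X: "D fls_X = fls_X"
  by (simp add: D_def)

lemma D_fps_to_fls: "D (fps_to_fls f) = fps_to_fls (D_fps f)"
  by (simp add: D_def D_fps_def fls_deriv_fps_to_fls fls_times_fps_to_fls)

section \<open>Orders and leading terms of Laurent series\<close>

definition val :: "int \<Rightarrow> complex fls \<Rightarrow> bool" where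
  "val n f \<longleftrightarrow> (\<forall>k<n. fls_nth f k = 0)"

lemma val_iff: "val n f \<longleftrightarrow> f = 0 \<or> n \<le> fls_subdegree f"
  unfolding val_def by (metis fls_eq0_below_subdegree fls_subdegree_geI fls_zero_nth not_less order.strict_trans2)

lemma val_add: "val n f \<Longrightarrow> val n g \<Longrightarrow> val n (f + g)"
  by (simp add: val_def)

lemma val_mult: "val n f \<Longrightarrow> val m g \<Longrightarrow> val (n + m) (f * g)"
  by (cases "f = 0 \<or> g = 0") (auto simp: val_iff)

lemma val_cancel:
  assumes "val n (f * g)" "f \<noteq> 0"
  shows "val (n - fls_subdegree f) g"
  using assms by (cases "g = 0") (auto simp: val_iff)

text \<open>\<open>f = c X\<^sup>k + O(X\<^bsup>k+p\<^esup>)\<close>\<close>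

definition lead :: "int \<Rightarrow> int \<Rightarrow> complex \<Rightarrow> complex fls \<Rightarrow> bool" where
  "lead p k c f \<longleftrightarrow> (\<forall>n<k+p. fls_nth f n = (if n = k then c else 0))"

lemma lead_iff_val: "lead p k c f \<longleftrightarrow> val (k + p) (f - fls_const c * fls_X_intpow k)"
  unfolding lead_def val_def by auto

lemma lead_val: "p \<ge> 0 \<Longrightarrow> lead p k c f \<Longrightarrow> val k f"
  unfolding lead_def val_def by auto

lemma lead_add: "lead p k c f \<Longrightarrow> lead p k e g \<Longrightarrow> lead p k (c + e) (f + g)"
  by (simp add: lead_def)

lemma lead_diff: "lead p k c f \<Longrightarrow> lead p k e g \<Longrightarrow> lead p k (c - e) (f - g)"
  by (simp add: lead_def)

lemma lead_uminus: "lead p k c f \<Longrightarrow> lead p k (- c) (- f)"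
  by (simp add: lead_def)

lemma lead_D: "lead p k c f \<Longrightarrow> lead p k (of_int k * c) (D f)"
  by (simp add: lead_def)

lemma lead_const: "p \<ge> 0 \<Longrightarrow> lead p 0 c (fls_const c)"
  by (simp add: lead_def)

lemma lead_numeral: "p \<ge> 0 \<Longrightarrow> lead p 0 (numeral n) (numeral n)"
  using lead_const[of p "numeral n"] by simp

lemma lead_1: "p \<ge> 0 \<Longrightarrow> lead p 0 1 1"
  using lead_const[of p 1] by simp

lemma lead_X: "p \<ge> 0 \<Longrightarrow> lead p 1 1 fls_X"
  by (simp add: lead_def)

lemma lead_mult:
  assumes "p \<ge> 0" "lead p k c f" "lead p m e g"
  shows "lead p (k + m) (c * e) (f * g)"
proof -
  have eq: "f * g - fls_const (c * e) * fls_X_intpow (k + m) =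
      (f - fls_const c * fls_X_intpow k) * g
      + (fls_const c * fls_X_intpow k) * (g - fls_const e * fls_X_intpow m)"
    by (simp add: algebra_simps fls_X_intpow_times_fls_X_intpow flip: fls_const_mult_const)
  have "val ((k + p) + m) ((f - fls_const c * fls_X_intpow k) * g)"
    using assms by (intro val_mult[OF _ lead_val]) (auto simp: lead_iff_val)
  moreover have "val (k + (m + p)) ((fls_const c * fls_X_intpow k) * (g - fls_const e * fls_X_intpow m))"
    using assms by (intro val_mult) (auto simp: lead_iff_val val_def)
  ultimately show ?thesis
    unfolding lead_iff_val eq by (intro val_add) (simp_all add: algebra_simps)
qed

lemma lead_mult0: "p \<ge> 0 \<Longrightarrow> lead p 0 c f \<Longrightarrow> lead p k e g \<Longrightarrow> lead p k (c * e) (f * g)"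
  using lead_mult[of p 0 c f k e g] by simp

lemma lead_nth: "p > 0 \<Longrightarrow> lead p k c f \<Longrightarrow> fls_nth f k = c"
  by (simp add: lead_def)

lemma lead_nonzero: "p > 0 \<Longrightarrow> lead p k c f \<Longrightarrow> c \<noteq> 0 \<Longrightarrow> f \<noteq> 0"
  using lead_nth by fastforce

text \<open>The expected leading monomial, multiplied by \<open>f\<close>, agrees with
  \<open>g\<close> below order \<open>m + p\<close>; cancelling \<open>f\<close>, of order
  \<open>k\<close>, bounds the error of the quotient.\<close>

lemma lead_divide:
  assumes p: "p > 0" and f: "lead p k c f" "c \<noteq> 0" and g: "lead p m e g"
  shows "lead p (m - k) (e / c) (g / f)"
proof -
  have nz: "f \<noteq> 0" using lead_nonzero[OF p f] .
  have sub: "fls_subdegree f = k"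
    using f p by (intro fls_subdegree_eqI) (auto simp: lead_def)
  have "lead p (m - k) (e / c) (fls_const (e / c) * fls_X_intpow (m - k))"
    using p by (simp add: lead_def)
  then have "lead p (k + (m - k)) (c * (e / c)) (f * (fls_const (e / c) * fls_X_intpow (m - k)))"
    using p f by (intro lead_mult) auto
  then have "lead p m (e - e) (g - f * (fls_const (e / c) * fls_X_intpow (m - k)))"
    using f by (intro lead_diff g) simp
  then have "val (m + p) (f * (g / f - fls_const (e / c) * fls_X_intpow (m - k)))"
    using nz unfolding lead_iff_val by (simp add: right_diff_distrib)
  from val_cancel[OF this nz] show ?thesis
    by (simp add: lead_iff_val sub algebra_simps)
qed

text \<open>A solution of a first order equation at the regular singular point \<open>0\<close> begins with the
  exponent of that equation.\<close>

lemma D_eq_mult_imp_zero: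
  assumes DS: "D S = h * S" and h: "lead 1 0 (of_int n) h" and S: "fls_nth S n = 0"
  shows "S = 0"
proof (rule ccontr)
  assume nz: "S \<noteq> 0"
  define m where "m = fls_subdegree S"
  have "lead 1 m (fls_nth S m) S"
    using nz by (auto simp: lead_def m_def)
  then have "lead 1 m (of_int n * fls_nth S m) (D S)"
    unfolding DS by (intro lead_mult0 h) auto
  then have "of_int m * fls_nth S m = of_int n * fls_nth S m"
    by (simp add: lead_def)
  then have "m = n"
    using nz by (simp add: m_def)
  then show False
    using nz S by (metis m_def nth_fls_subdegree_nonzero)
qed

section \<open>The basic series\<close>

lemma D_fps_nth: "fps_nth (D_fps A) n = of_nat n * fps_nth A n"
  by (cases n) (simp_all add: D_fps_def)

text \<open>Both series \<open>L\<close> are of this type, with \<open>c = 5^5\<close>,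
  \<open>k = 1\<close> and, up to the factor \<open>- \<psi>\<close>, \<open>c = 1 / 5^5\<close>,
  \<open>k = 5\<close>. The fifth power of \<open>(1 + x)^(-1/5)\<close> replaces the denominator
  \<open>1 + x\<close> in its derivative, and \<open>c x^k N^5 = 1 - N^5\<close>.\<close>

lemma fps_binomial_root:
  fixes c :: complex
  assumes k: "k > 0"
  defines "N \<equiv> fps_binomial (- 1 / 5) oo (fps_const c * fps_X ^ k)"
  shows "N ^ 5 * (1 + fps_const c * fps_X ^ k) = 1"
    and "5 * D_fps N = - of_nat k * N * (1 - N ^ 5)"
    and "fps_nth N 0 = 1"
proof -
  let ?b = "fps_binomial (- 1 / 5) :: complex fps"
  let ?z = "fps_const c * fps_X ^ k :: complex fps"
  have z0: "fps_nth ?z 0 = 0" using k by simp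
  have b5: "?b ^ 5 = inverse (1 + fps_X)"
    using fps_binomial_power[of "- 1 / 5 :: complex" 5] by (simp add: fps_binomial_minus_one)
  have "?b ^ 5 * (1 + fps_X) = 1"
    unfolding b5 by (rule inverse_mult_eq_1) simp
  then have "(?b ^ 5 * (1 + fps_X)) oo ?z = 1 oo ?z" by simp
  then show r: "N ^ 5 * (1 + ?z) = 1"
    using z0 by (simp add: N_def fps_compose_mult_distrib fps_compose_add_distrib fps_compose_power)
  have "fps_deriv ?b = fps_const (- 1 / 5) * ?b * ?b ^ 5"
    unfolding fps_binomial_deriv b5 by (rule fps_divide_unit) simp
  then have "fps_deriv N = (fps_const (- 1 / 5) * ?b * ?b ^ 5 oo ?z) * fps_deriv ?z"
    unfolding N_def using fps_compose_deriv[OF z0, of ?b] by simp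
  also have "(fps_const (- 1 / 5) * ?b * ?b ^ 5 oo ?z) = fps_const (- 1 / 5) * N * N ^ 5"
    using z0 by (simp add: N_def fps_compose_mult_distrib fps_compose_power)
  finally have "5 * D_fps N = (5 * fps_const (- 1 / 5)) * N * N ^ 5 * (fps_X * fps_deriv ?z)"
    by (simp add: D_fps_def mult_ac)
  also have "5 * fps_const (- 1 / 5) = (- 1 :: complex fps)"
    by (metis fps_const_1_eq_1 fps_const_mult fps_const_neg mult_minus_right
        nonzero_mult_div_cancel_left numeral_fps_const times_divide_eq_right zero_neq_numeral)
  also have "fps_X * fps_deriv ?z = of_nat k * ?z"
    by (rule fps_ext, unfold D_fps_def[symmetric]) (simp add: D_fps_nth flip: fps_of_nat)
  also have "- 1 * N * N ^ 5 * (of_nat k * ?z) = - of_nat k * N * (N ^ 5 * ?z)"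
    by (simp add: mult_ac)
  also have "N ^ 5 * ?z = 1 - N ^ 5"
    using r by (simp add: algebra_simps)
  finally show "5 * D_fps N = - of_nat k * N * (1 - N ^ 5)" .
  show "fps_nth N 0 = 1"
    by (simp add: N_def)
qed

lemma L_K_props:
  "5 * D L_K = L_K * (L_K ^ 5 - 1)"
  "L_K ^ 5 * (1 + fls_const (5 ^ 5) * fls_X) = 1"
  "fls_nth L_K 0 = 1" "L_K \<noteq> 0" "val 0 L_K"
proof -
  note r = fps_binomial_root[of 1 "5 ^ 5", simplified power_one_right]
  show "5 * D L_K = L_K * (L_K ^ 5 - 1)"
    using arg_cong[OF r(2), of fps_to_fls]
    by (simp add: L_K_def D_fps_to_fls fls_times_fps_to_fls fps_to_fls_power algebra_simps)
  show "L_K ^ 5 * (1 + fls_const (5 ^ 5) * fls_X) = 1"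
    using arg_cong[OF r(1), of fps_to_fls]
    by (simp add: L_K_def fls_times_fps_to_fls fps_to_fls_power)
  show 0: "fls_nth L_K 0 = 1"
    using r(3) by (simp add: L_K_def)
  then show "L_K \<noteq> 0" by auto
  show "val 0 L_K" by (simp add: L_K_def val_def)
qed

definition l_O :: "complex fls" where "l_O = - L_O / 5"

text \<open>\<open>l_O\<close> is the image of \<open>L\<close> under \<open>T\<close>. It satisfies
  for \<open>- D\<close> the equation that \<open>L_K\<close> satisfies for \<open>5 * D\<close>,
  but it vanishes at \<open>\<psi> = 0\<close>, whereas \<open>L_K\<close> has value 1 at
  \<open>q = 0\<close>.\<close>

lemma l_O_props:
  "- D l_O = l_O * (l_O ^ 5 - 1)"
  "l_O ^ 5 = fls_const (1 / 5 ^ 5) * fls_X ^ 5 * (1 - l_O ^ 5)"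
  "lead 1 1 (1 / 5) l_O" "l_O \<noteq> 0"
proof -
  define N where "N = fps_to_fls (fps_binomial (- 1 / 5) oo (fps_const (1 / 5 ^ 5 :: complex) * fps_X ^ 5))"
  note r = fps_binomial_root[of 5 "1 / 5 ^ 5"]
  have l: "l_O = fls_const (1 / 5) * fls_X * N"
    by (simp add: l_O_def L_O_def fls_divide_numeral N_def)
  have N: "N ^ 5 * (1 + fls_const (1 / 5 ^ 5) * fls_X ^ 5) = 1"
    using arg_cong[OF r(1), of fps_to_fls]
    by (simp add: N_def fls_times_fps_to_fls fps_to_fls_power)
  have DN: "D N = - N * (1 - N ^ 5)"
    using arg_cong[OF r(2), of fps_to_fls]
    by (simp add: N_def D_fps_to_fls fls_times_fps_to_fls fps_to_fls_power)
  have l5: "l_O ^ 5 = fls_const (1 / 5 ^ 5) * fls_X ^ 5 * N ^ 5"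
    by (simp only: l power_mult_distrib fls_const_power[symmetric] power_divide power_one)
  have N5: "N ^ 5 = 1 - l_O ^ 5"
    using N unfolding l5 by (simp add: algebra_simps)
  show "l_O ^ 5 = fls_const (1 / 5 ^ 5) * fls_X ^ 5 * (1 - l_O ^ 5)"
    using l5 unfolding N5 .
  show "- D l_O = l_O * (l_O ^ 5 - 1)"
    unfolding l D_mult D_const D_fls_X DN unfolding l[symmetric] N5
    by (simp add: l algebra_simps)
  have "lead 1 0 1 N"
    using r(3) by (simp add: N_def lead_def)
  from lead_mult[OF _ lead_mult0[OF _ lead_const lead_X, of 1 "1/5"] this]
  show ld: "lead 1 1 (1 / 5) l_O"
    by (simp add: l)
  show "l_O \<noteq> 0"
    using lead_nonzero[OF _ ld] by simp
qed

section \<open>Coefficients in the auxiliary variable\<close>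

lemma coeffwise_nth [simp]: "fps_nth (coeffwise h A) n = h (fps_nth A n)"
  by (simp add: coeffwise_def)

lemma coeffwise_const_1: "coeffwise fls_const 1 = 1"
  by (rule fps_ext) simp

text \<open>The factor \<open>1/w\<close>, or \<open>z = 1/u\<close>, moves the coefficient of index
  1 to index 0; so \<open>C_2\<close> is read off from the first order part of
  \<open>F_1\<close>.\<close>

lemma coeffwise_shift_D:
  "coeffwise (\<lambda>f. fls_nth f 0) (fps_const (inverse fls_X) * D_fps A) =
     D_fps (coeffwise (\<lambda>f. fls_nth f 1) (A :: complex fls fps))"
proof (rule fps_ext)
  fix n
  have "fls_nth (inverse fls_X * (of_nat n * f)) 0 = of_nat n * fls_nth f 1" for f :: "complex fls"
    by (simp add: fls_inverse_X fls_X_inv_times_conv_shift fls_of_nat)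
  then show "fps_nth (coeffwise (\<lambda>f. fls_nth f 0) (fps_const (inverse fls_X) * D_fps A)) n
      = fps_nth (D_fps (coeffwise (\<lambda>f. fls_nth f 1) A)) n"
    by (simp add: D_fps_nth)
qed

text \<open>The hypotheses make the divisor divide \<open>A\<close>, so the division is exact and
  commutes with extracting a coefficient. The order \<open>m\<close> is 0 for \<open>KP^4\<close>
  and 1 for the orbifold, where \<open>C_1\<close> vanishes at the origin.\<close>

lemma coeffwise_divide_const:
  fixes A :: "complex fls fps" and v :: "complex fps"
  assumes v: "fps_nth v m \<noteq> 0" and A: "\<And>n. n < m \<Longrightarrow> fps_nth A n = 0"
  shows "fps_to_fls (coeffwise (\<lambda>f. fls_nth f k) (A / coeffwise fls_const v)) =
    fps_to_fls (coeffwise (\<lambda>f. fls_nth f k) A) / fps_to_fls v"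
proof -
  let ?V = "coeffwise fls_const v" and ?c = "coeffwise (\<lambda>f. fls_nth f k)"
  have vn: "v \<noteq> 0" using v by auto
  have "fps_nth ?V m \<noteq> 0" using v by simp
  then have V: "?V \<noteq> 0" "subdegree ?V \<le> m"
    by (metis fps_zero_nth) (rule subdegree_leI, fact)
  have "A = 0 \<or> m \<le> subdegree A"
    using A by (metis subdegree_geI)
  then have "?V dvd A"
    using V by (cases "A = 0") (auto simp: fps_dvd_iff)
  then have "?c A = ?c (A / ?V * ?V)" by simp
  also have "\<dots> = ?c (A / ?V) * v"
    by (rule fps_ext) (simp add: fps_mult_nth fls_nth_sum)
  finally show ?thesis
    using vn by (simp add: fls_times_fps_to_fls)
qed

section \<open>First order expansion in \<open>w\<close> of the series of
  \<open>KP^4\<close>\<close>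

definition dual :: "complex fls \<Rightarrow> complex \<Rightarrow> complex \<Rightarrow> bool" where
  "dual A a b \<longleftrightarrow> val 0 A \<and> fls_nth A 0 = a \<and> fls_nth A 1 = b"

lemma dual_mult:
  assumes "dual A a b" "dual B c e"
  shows "dual (A * B) (a * c) (a * e + b * c)"
proof -
  have A: "fps_to_fls (fls_regpart A) = A" and B: "fps_to_fls (fls_regpart B) = B"
    using assms by (auto simp: dual_def val_def intro!: fls_eqI)
  have "A * B = fps_to_fls (fls_regpart A * fls_regpart B)"
    by (simp add: fls_times_fps_to_fls A B)
  then show ?thesis
    using assms by (simp add: dual_def val_def fps_mult_nth_1)
qed

lemma dual_affine: "dual (fls_const c * fls_X + fls_const e) e c"
  by (simp add: dual_def val_def)

text \<open>The factor \<open>k = 0\<close> in the numerator of \<open>I\<close> cancels the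
  pole at \<open>w = 0\<close>.\<close>

definition A_K :: "nat \<Rightarrow> complex fls" where
  "A_K d = fps_nth I_K d * (fls_X + of_nat d) * inverse fls_X"

lemma fls_X_add_nz: "fls_X + of_nat k \<noteq> (0 :: complex fls)"
proof
  assume "fls_X + of_nat k = (0 :: complex fls)"
  then have "fls_nth (fls_X + of_nat k :: complex fls) 1 = 0" by simp
  then show False by (simp add: fls_of_nat)
qed

lemma A_K_0: "A_K 0 = 1"
  by (simp add: A_K_def I_K_def)

text \<open>Of the five new numerator factors, \<open>- 5 w - 5 d\<close> provides the
  \<open>w + d\<close> in \<open>A_K d\<close>; the \<open>w + d + 1\<close> in
  \<open>A_K (Suc d)\<close> lowers the fifth power in the denominator to the fourth.\<close>

lemma A_K_Suc:
  "(fls_X + of_nat (Suc d)) ^ 4 * A_K (Suc d) =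
    - 5 * (5 * fls_X + of_nat (5 * d + 1)) * (5 * fls_X + of_nat (5 * d + 2))
      * (5 * fls_X + of_nat (5 * d + 3)) * (5 * fls_X + of_nat (5 * d + 4)) * A_K d"
proof -
  let ?x = "fls_X :: complex fls"
  let ?y = "?x + of_nat (Suc d)"
  have nz: "?y \<noteq> 0" by (rule fls_X_add_nz)
  have den: "(\<Prod>k=1..d. (?x + of_nat k) ^ 5) \<noteq> 0" by (simp add: fls_X_add_nz del: of_nat_Suc)
  have S: "5 * Suc d = Suc (5 * d + 4)" "5 * d + 4 = Suc (5 * d + 3)" "5 * d + 3 = Suc (5 * d + 2)"
    "5 * d + 2 = Suc (5 * d + 1)" "5 * d + 1 = Suc (5 * d)" by simp_all
  have num: "(\<Prod>k<5 * Suc d. - 5 * ?x - of_nat k) = (\<Prod>k<5 * d. - 5 * ?x - of_nat k) *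
      ((- 5 * ?x - of_nat (5 * d)) * (- 5 * ?x - of_nat (5 * d + 1)) * (- 5 * ?x - of_nat (5 * d + 2))
      * (- 5 * ?x - of_nat (5 * d + 3)) * (- 5 * ?x - of_nat (5 * d + 4)))"
    by (simp only: S prod.lessThan_Suc mult.assoc)
  have den': "(\<Prod>k=1..Suc d. (?x + of_nat k) ^ 5) = (\<Prod>k=1..d. (?x + of_nat k) ^ 5) * ?y ^ 5"
    by (simp del: of_nat_Suc)
  have cancel: "(a * b) / (c * e) * e = a / c * b" if "e \<noteq> 0" for a b c e :: "complex fls"
    using that by simp
  have I: "fps_nth I_K (Suc d) * ?y ^ 5 = fps_nth I_K d * ((- 5 * ?x - of_nat (5 * d)) *
      (- 5 * ?x - of_nat (5 * d + 1)) * (- 5 * ?x - of_nat (5 * d + 2)) * (- 5 * ?x - of_nat (5 * d + 3))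
      * (- 5 * ?x - of_nat (5 * d + 4)))"
    unfolding I_K_def fps_nth_Abs_fps num den' by (rule cancel) (use nz in simp)
  have "?y * (?y ^ 4 * A_K (Suc d) * ?x) = ?y * (fps_nth I_K (Suc d) * ?y ^ 5)"
    by (simp add: A_K_def power_eq_if del: of_nat_Suc)
  also have "\<dots> = ?y * (- 5 * (5 * ?x + of_nat (5 * d + 1)) * (5 * ?x + of_nat (5 * d + 2))
      * (5 * ?x + of_nat (5 * d + 3)) * (5 * ?x + of_nat (5 * d + 4)) * (fps_nth I_K d * (?x + of_nat d)))"
    unfolding I by (simp add: algebra_simps)
  also have "fps_nth I_K d * (?x + of_nat d) = A_K d * ?x"
    by (simp add: A_K_def)
  finally show ?thesis
    using nz by (simp del: of_nat_Suc add: mult_ac)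
qed

lemma dual_fls_X_add: "dual (fls_X + of_nat n) (of_nat n) 1"
  using dual_affine[of 1 "of_nat n"] by (simp add: fls_of_nat)

lemma dual_5X_add: "dual (5 * fls_X + of_nat n) (of_nat n) 5"
  using dual_affine[of 5 "of_nat n"] by (simp add: fls_of_nat)

lemma val_A_K: "val 0 (A_K d)"
proof (induction d)
  case 0
  show ?case by (simp add: A_K_0 val_def)
next
  case (Suc d)
  have v: "val 0 (a * b)" if "val 0 a" "val 0 b" for a b
    using val_mult[OF that] by simp
  have f: "val 0 (5 * fls_X + of_nat n)" for n
    using dual_5X_add[of n] by (simp add: dual_def)
  have "val 0 ((fls_X + of_nat (Suc d)) ^ 4 * A_K (Suc d))"
    unfolding A_K_Suc by (intro v f Suc) (simp add: val_def)
  moreover have "fls_subdegree (fls_X + of_nat (Suc d) :: complex fls) = 0"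
    by (intro fls_subdegree_eqI) (simp_all add: fls_of_nat del: of_nat_Suc)
  ultimately show ?case
    using val_cancel[of 0 "(fls_X + of_nat (Suc d)) ^ 4" "A_K (Suc d)"] fls_X_add_nz[of "Suc d"]
    by (simp add: fls_subdegree_pow del: of_nat_Suc)
qed

text \<open>\<open>F_K 1\<close> is \<open>u_K + w g_K + O(w^2)\<close>.\<close>

definition u_K :: "complex fps" where "u_K = Abs_fps (\<lambda>d. fls_nth (A_K d) 0)"
definition g_K :: "complex fps" where "g_K = Abs_fps (\<lambda>d. fls_nth (A_K d) 1)"

lemma u_g_K_0: "fps_nth u_K 0 = 1" "fps_nth g_K 0 = 0"
  by (simp_all add: u_K_def g_K_def A_K_0)

text \<open>The recursion of \<open>A_K\<close> modulo \<open>w^2\<close>. Apart from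
  \<open>A_K d\<close>, its right side is a polynomial in \<open>t + 5 w\<close>; hence the factor 5
  before the derivative polynomial in the first order part.\<close>

lemma u_g_K_Suc:
  fixes d :: nat
  defines "t \<equiv> 5 * of_nat d :: complex" and "s \<equiv> of_nat (Suc d) :: complex"
  shows "s ^ 4 * fps_nth u_K (Suc d) = - 5 * (t ^ 4 + 10 * t ^ 3 + 35 * t ^ 2 + 50 * t + 24) * fps_nth u_K d"
    and "s ^ 4 * fps_nth g_K (Suc d) + 4 * s ^ 3 * fps_nth u_K (Suc d) =
      - 5 * ((t ^ 4 + 10 * t ^ 3 + 35 * t ^ 2 + 50 * t + 24) * fps_nth g_K d
        + 5 * (4 * t ^ 3 + 30 * t ^ 2 + 70 * t + 50) * fps_nth u_K d)"
proof -
  have A: "dual (A_K d) (fps_nth u_K d) (fps_nth g_K d)" for d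
    by (simp add: dual_def val_A_K u_K_def g_K_def)
  have m5: "dual (- 5) (- 5) 0"
    by (simp add: dual_def val_def)
  note x = dual_fls_X_add[of "Suc d"]
  note y = dual_5X_add[of "5 * d + k" for k]
  have "dual ((fls_X + of_nat (Suc d)) ^ 4) (s ^ 4) (4 * s ^ 3)"
    using dual_mult[OF dual_mult[OF x x] dual_mult[OF x x]]
    by (simp add: s_def eval_nat_numeral algebra_simps del: of_nat_Suc)
  note l = dual_mult[OF this A[of "Suc d"], unfolded A_K_Suc]
  note r = dual_mult[OF dual_mult[OF dual_mult[OF dual_mult[OF dual_mult[OF m5 y] y] y] y] A[of d]]
  from l r[of 1 2 3 4] show
    "s ^ 4 * fps_nth u_K (Suc d) = - 5 * (t ^ 4 + 10 * t ^ 3 + 35 * t ^ 2 + 50 * t + 24) * fps_nth u_K d"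
    "s ^ 4 * fps_nth g_K (Suc d) + 4 * s ^ 3 * fps_nth u_K (Suc d) =
      - 5 * ((t ^ 4 + 10 * t ^ 3 + 35 * t ^ 2 + 50 * t + 24) * fps_nth g_K d
        + 5 * (4 * t ^ 3 + 30 * t ^ 2 + 70 * t + 50) * fps_nth u_K d)"
    by (simp_all add: dual_def t_def eval_nat_numeral algebra_simps)
qed

text \<open>For \<open>d > 0\<close> the coefficient is \<open>w * A_K d / (w + d)\<close> with
  \<open>w + d\<close> a unit, so it vanishes at \<open>w = 0\<close>.\<close>

lemma at_w0_I_K: "at_w0 I_K = 1"
proof (rule fps_ext)
  fix d
  show "fps_nth (at_w0 I_K) d = fps_nth 1 d"
  proof (cases d)
    case 0
    then show ?thesis by (simp add: at_w0_def I_K_def)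
  next
    case (Suc m)
    have "(fls_X + of_nat d) * fps_nth I_K d = fls_X * A_K d"
      by (simp add: A_K_def)
    moreover have "val 1 (fls_X * A_K d)"
      using val_mult[OF _ val_A_K, of 1 fls_X d] by (simp add: val_def)
    ultimately have "val 1 ((fls_X + of_nat d) * fps_nth I_K d)" by simp
    moreover have "fls_subdegree (fls_X + of_nat d :: complex fls) = 0"
      using Suc by (intro fls_subdegree_eqI) (simp_all add: fls_of_nat del: of_nat_Suc)
    ultimately have "val 1 (fps_nth I_K d)"
      using val_cancel[of 1 "fls_X + of_nat d" "fps_nth I_K d"] fls_X_add_nz[of d] by simp
    then show ?thesis
      using Suc by (simp add: at_w0_def val_def)
  qed
qed

text \<open>\<open>1 + D / w\<close> multiplies the coefficient of \<open>q^d\<close> by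
  \<open>(w + d) / w\<close>, which is how \<open>A_K\<close> arises.\<close>

lemma F_K_1: "F_K 1 = Abs_fps A_K"
proof (rule fps_ext)
  fix d
  have "fps_nth (F_K 1) d = fps_nth I_K d + inverse fls_X * (of_nat d * fps_nth I_K d)"
    by (simp add: at_w0_I_K coeffwise_const_1 D_fps_nth)
  also have "\<dots> = A_K d"
    by (simp add: A_K_def algebra_simps)
  finally show "fps_nth (F_K 1) d = fps_nth (Abs_fps A_K) d" by simp
qed

lemma C_K_1: "C_K 1 = fps_to_fls u_K"
  unfolding C_K_def at_w0_def F_K_1 by (simp add: u_K_def coeffwise_def)

lemma C_K_2: "C_K 2 = 1 + D (fps_to_fls g_K / fps_to_fls u_K)"
proof -
  have u: "at_w0 (F_K 1) = u_K"
    unfolding at_w0_def F_K_1 by (simp add: u_K_def coeffwise_def)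
  define G where "G = F_K 1 / coeffwise fls_const u_K"
  have div: "fps_to_fls (coeffwise (\<lambda>f. fls_nth f k) G) = fps_to_fls (coeffwise (\<lambda>f. fls_nth f k) (F_K 1)) / fps_to_fls u_K" for k
    unfolding G_def using u_g_K_0 by (intro coeffwise_divide_const[of _ 0]) auto
  have u0: "fps_to_fls u_K \<noteq> 0"
    using u_g_K_0 by auto
  have g: "coeffwise (\<lambda>f. fls_nth f 1) (F_K 1) = g_K"
    unfolding F_K_1 by (simp add: g_K_def coeffwise_def)
  have "F_K 2 = G + fps_const (inverse fls_X) * D_fps G"
    using u by (simp add: G_def Let_def numeral_2_eq_2 del: F_K.simps(1))
  then have "at_w0 (F_K 2) = coeffwise (\<lambda>f. fls_nth f 0) G + coeffwise (\<lambda>f. fls_nth f 0) (fps_const (inverse fls_X) * D_fps G)"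
    by (auto simp: at_w0_def intro!: fps_ext)
  then have "C_K 2 = fps_to_fls (coeffwise (\<lambda>f. fls_nth f 0) G) + D (fps_to_fls (coeffwise (\<lambda>f. fls_nth f 1) G))"
    by (simp add: C_K_def coeffwise_shift_D D_fps_to_fls)
  also have "fps_to_fls (coeffwise (\<lambda>f. fls_nth f 0) G) = 1"
    using u u0 by (simp add: div at_w0_def)
  finally show ?thesis
    unfolding div g .
qed

lemma fls_eq_powerseriesI:
  assumes "\<And>n. n < 0 \<Longrightarrow> fls_nth f n = 0" "fls_nth f 0 = 0" "\<And>n. fls_nth f (1 + int n) = 0"
  shows "f = 0"
proof (rule fls_eqI)
  fix n :: int
  consider "n < 0" | "n = 0" | "n > 0" by linarith
  then show "fls_nth f n = fls_nth 0 n"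
  proof cases
    case 3
    then show ?thesis using assms(3)[of "nat (n - 1)"] by simp
  qed (use assms in auto)
qed

text \<open>With \<open>z = 5^5 q\<close> the recursions are \<open>d^4 u + z P u = 0\<close> and
  the analogous equation for \<open>g\<close>; as \<open>z L^5 = 1 - L^5\<close>, multiplying them
  by \<open>L^5\<close> gives the claims.\<close>

lemma L_op_K:
  defines "u \<equiv> fps_to_fls u_K" and "g \<equiv> fps_to_fls g_K"
  shows "D5.L_op (L_K ^ 5) u = 0" and "D5.L_op (L_K ^ 5) g + 5 * D5.L_op' (L_K ^ 5) u = 0"
proof -
  let ?d = "\<lambda>f. 5 * D f"
  let ?z = "fls_const (5 ^ 5) * fls_X :: complex fls"
  let ?P = "\<lambda>u. ?d (?d (?d (?d u))) + 10 * ?d (?d (?d u)) + 35 * ?d (?d u) + 50 * ?d u + 24 * u"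
  let ?Q = "\<lambda>u. 4 * ?d (?d (?d u)) + 30 * ?d (?d u) + 70 * ?d u + 50 * u"
  have d: "fls_nth (?d f) n = 5 * of_int n * fls_nth f n" for f n
    by (simp add: mult.assoc)
  have num: "fls_nth (numeral k * f) n = numeral k * fls_nth f n" for k n and f :: "complex fls"
    by (simp flip: fls_const_numeral)
  have X: "fls_nth (fls_X * f) n = fls_nth f (n - 1)" for f :: "complex fls" and n
    by (simp add: fls_X_times_conv_shift)
  have e1: "?d (?d (?d (?d u))) + ?z * ?P u = 0"
  proof (rule fls_eq_powerseriesI)
    fix m :: nat
    have "fls_nth (?d (?d (?d (?d u))) + ?z * ?P u) (1 + int m) =
      625 * (of_nat (Suc m) ^ 4 * fps_nth u_K (Suc m)) +
      5 ^ 5 * (((5 * of_nat m) ^ 4 + 10 * (5 * of_nat m) ^ 3 + 35 * (5 * of_nat m) ^ 2 + 50 * (5 * of_nat m) + 24) * fps_nth u_K m)"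
      by (simp add: d num X u_def nat_add_distrib mult.assoc) (simp add: eval_nat_numeral algebra_simps)
    also have "\<dots> = 0"
      unfolding u_g_K_Suc by algebra
    finally show "fls_nth (?d (?d (?d (?d u))) + ?z * ?P u) (1 + int m) = 0" .
  qed (simp_all add: d num X u_def mult.assoc)
  have e2: "?d (?d (?d (?d g))) + 20 * ?d (?d (?d u)) + ?z * (?P g + 5 * ?Q u) = 0"
  proof (rule fls_eq_powerseriesI)
    fix m :: nat
    let ?t = "5 * of_nat m :: complex" and ?s = "of_nat (Suc m) :: complex"
    have "fls_nth (?d (?d (?d (?d g))) + 20 * ?d (?d (?d u)) + ?z * (?P g + 5 * ?Q u)) (1 + int m) =
      625 * (?s ^ 4 * fps_nth g_K (Suc m) + 4 * ?s ^ 3 * fps_nth u_K (Suc m)) +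
      5 ^ 5 * ((?t ^ 4 + 10 * ?t ^ 3 + 35 * ?t ^ 2 + 50 * ?t + 24) * fps_nth g_K m
        + 5 * (4 * ?t ^ 3 + 30 * ?t ^ 2 + 70 * ?t + 50) * fps_nth u_K m)"
      by (simp add: d num X u_def g_def nat_add_distrib mult.assoc) (simp add: eval_nat_numeral algebra_simps)
    also have "\<dots> = 0"
      unfolding u_g_K_Suc by algebra
    finally show "fls_nth (?d (?d (?d (?d g))) + 20 * ?d (?d (?d u)) + ?z * (?P g + 5 * ?Q u)) (1 + int m) = 0" .
  qed (simp_all add: d num X u_def g_def mult.assoc)
  have zL: "?z * L_K ^ 5 = 1 - L_K ^ 5"
    using L_K_props(2) by (simp add: algebra_simps)
  have "D5.L_op (L_K ^ 5) u = L_K ^ 5 * ?d (?d (?d (?d u))) + (1 - L_K ^ 5) * ?P u"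
    unfolding D5.L_op_def by (simp add: algebra_simps)
  also have "\<dots> = L_K ^ 5 * (?d (?d (?d (?d u))) + ?z * ?P u)"
    by (simp add: zL[symmetric] distrib_left mult_ac)
  finally show "D5.L_op (L_K ^ 5) u = 0"
    unfolding e1 by (simp only: mult_zero_right)
  have "D5.L_op (L_K ^ 5) g + 5 * D5.L_op' (L_K ^ 5) u = L_K ^ 5 * (?d (?d (?d (?d g))) + 20 * ?d (?d (?d u)))
     + (1 - L_K ^ 5) * (?P g + 5 * ?Q u)"
    unfolding D5.L_op_def D5.L_op'_def by (simp add: algebra_simps)
  also have "\<dots> = L_K ^ 5 * (?d (?d (?d (?d g))) + 20 * ?d (?d (?d u)) + ?z * (?P g + 5 * ?Q u))"
    by (simp add: zL[symmetric] distrib_left mult_ac)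
  finally show "D5.L_op (L_K ^ 5) g + 5 * D5.L_op' (L_K ^ 5) u = 0"
    unfolding e2 by (simp only: mult_zero_right)
qed

lemma lead_cong: "lead p k c f \<Longrightarrow> c = e \<Longrightarrow> lead p k e f"
  by simp

lemma relations_K:
  defines "d \<equiv> \<lambda>f. 5 * D f" and "x \<equiv> 5 * X_K" and "y \<equiv> 5 * Y_K" and "L \<equiv> L_K ^ 5"
  shows "d (d (d x)) = - (4 * x * d (d x) + 3 * d x * d x + 6 * x * x * d x + x ^ 4)
      - (1 - L) * (10 * (d (d x) + 3 * x * d x + x ^ 3) + 35 * (d x + x * x) + 50 * x + 24)"
    and "d y = - 4 * d x - 2 * x * x - 2 * x * y - y * y - 5 * (1 - L) * (2 * x + y + 2)"
proof -
  define u where "u = fps_to_fls u_K"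
  define g where "g = fps_to_fls g_K"
  define t where "t = 5 + d (g / u)"
  have u0: "u \<noteq> 0"
    using u_g_K_0 by (auto simp: u_def)
  have t: "t = 5 * C_K 2"
    by (simp add: t_def u_def g_def C_K_2 d_def)
  have lu: "lead 1 0 1 u" and lg: "lead 1 0 0 g"
    by (auto simp: lead_def u_def g_def u_g_K_0)
  have ld: "lead 1 0 0 (d f)" if "lead 1 0 c f" for c f
    unfolding d_def by (rule lead_cong, rule lead_mult0[OF _ lead_numeral lead_D[OF that]]) auto
  have lr: "lead 1 0 0 (g / u)"
    using lead_divide[OF _ lu _ lg] by simp
  have lt: "lead 1 0 5 t"
    unfolding t_def by (rule lead_cong, rule lead_add[OF lead_numeral ld[OF lr]]) auto
  have t0: "t \<noteq> 0"
    using lead_nonzero[OF _ lt] by simp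
  have L1: "lead 1 0 1 L"
  proof -
    have "lead 1 0 1 L_K"
      using L_K_props by (auto simp: lead_def val_def)
    then have "lead 1 0 1 (L_K ^ n)" for n
      by (induction n) (auto intro!: lead_1 lead_mult0[where c = 1 and e = 1, simplified])
    then show ?thesis by (simp add: L_def)
  qed
  have dL: "d L = 5 * L * (L - 1)"
    unfolding L_def d_def by (rule D5.d_power5[OF L_K_props(1)])
  have op: "D5.L_op L u = 0" "D5.L_op L (u * (g / u)) + 5 * D5.L_op' L u = 0"
    using L_op_K u0 by (simp_all add: L_def u_def g_def)
  have "D5.S_form L u t = 0"
  proof (rule D_eq_mult_imp_zero)
    have "5 * D (D5.S_form L u t) = - 5 * (1 - L) * D5.S_form L u t"
      using D5.d_S_form[OF dL[unfolded d_def] op] by (simp add: t_def d_def D5.d_numeral)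
    then have "5 * D (D5.S_form L u t) = 5 * (- (1 - L) * D5.S_form L u t)"
      by (simp only: mult_ac mult_minus_left mult_minus_right)
    then show "D (D5.S_form L u t) = - (1 - L) * D5.S_form L u t"
      by (simp only: mult_cancel_left) simp
    show "lead 1 0 (of_int 0) (- (1 - L))"
      by (rule lead_cong, rule lead_uminus[OF lead_diff[OF lead_1 L1]]) auto
    \<comment> \<open>Since \<open>L = 1\<close> at \<open>q = 0\<close>, the exponent is 0 and the
      constant term has to vanish. It does, because every term of \<open>S_form\<close> contains a
      derivative or the factor \<open>1 - L\<close>.\<close>
    have "lead 1 0 0 (D5.S_form L u t)"
      unfolding D5.S_form_def
      by (rule lead_cong, (rule lead_add lead_diff lead_uminus lead_mult0 lead_numeral lead_1 lu lt L1
            ld[OF lu, unfolded d_def] ld[OF ld[OF lu], unfolded d_def]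
            ld[OF lt, unfolded d_def] ld[OF ld[OF lt], unfolded d_def] | simp)+)
    then show "fls_nth (D5.S_form L u t) 0 = 0"
      by (simp add: lead_def)
  qed
  moreover have dux: "5 * D u = x * u"
    unfolding x_def X_K_def C_K_1 u_def[symmetric] using u0 by simp
  moreover have "5 * D t = y * t"
    using t0 unfolding y_def Y_K_def t by (simp add: D.d_simps)
  ultimately show "d y = - 4 * d x - 2 * x * x - 2 * x * y - y * y - 5 * (1 - L) * (2 * x + y + 2)"
    unfolding d_def using D5.relation_y u0 t0 by blast
  show "d (d (d x)) = - (4 * x * d (d x) + 3 * d x * d x + 6 * x * x * d x + x ^ 4)
      - (1 - L) * (10 * (d (d x) + 3 * x * d x + x ^ 3) + 35 * (d x + x * x) + 50 * x + 24)"
    unfolding d_def using D5.relation_x[OF op(1) dux u0] .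
qed

section \<open>Basic series of the orbifold\<close>

definition k_O :: "nat \<Rightarrow> nat \<Rightarrow> complex" where
  "k_O j i = of_nat i + of_nat j / 5"

lemma orbifold_index_set:
  "{k::rat. 0 \<le> k \<and> k < of_nat a / 5 \<and> frac k = frac (of_nat a / 5)} =
     (\<lambda>i. of_nat i + of_nat (a mod 5) / 5) ` {..<a div 5}"
proof -
  define r where "r = (of_nat (a mod 5) / 5 :: rat)"
  have r: "0 \<le> r" "r < 1"
    by (auto simp: r_def)
  have a: "of_nat a / 5 = (of_nat (a div 5) + r :: rat)"
  proof -
    have "(of_nat a :: rat) = of_nat (5 * (a div 5) + a mod 5)" by simp
    then show ?thesis unfolding r_def by (simp only: of_nat_add of_nat_mult) simp
  qed
  have fr: "frac (of_nat i + r) = r" for i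
    using r by (simp add: frac_unique_iff)
  show ?thesis
    unfolding a r_def[symmetric] fr
  proof (intro equalityI subsetI)
    fix k assume "k \<in> {k. 0 \<le> k \<and> k < of_nat (a div 5) + r \<and> frac k = r}"
    then have k: "0 \<le> k" "k < of_nat (a div 5) + r" "frac k = r" by auto
    then have "k = of_nat (nat \<lfloor>k\<rfloor>) + r"
      by (simp add: frac_def)
    moreover from this k have "nat \<lfloor>k\<rfloor> < a div 5"
      by (metis add_less_cancel_right of_nat_less_iff)
    ultimately show "k \<in> (\<lambda>i. of_nat i + r) ` {..<a div 5}"
      by blast
  next
    fix k assume "k \<in> (\<lambda>i. of_nat i + r) ` {..<a div 5}"
    then show "k \<in> {k. 0 \<le> k \<and> k < of_nat (a div 5) + r \<and> frac k = r}"
      using r by (auto simp: fr)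
  qed
qed

text \<open>As \<open>a = j + 5 (a div 5)\<close>, the factor \<open>u^a\<close> coming from
  \<open>1 / z^a\<close> can spend \<open>u^5\<close> on each of the \<open>a div 5\<close> factors
  of the product, clearing their poles.\<close>

lemma I_O_nth:
  "fps_nth (I_O j) a = (if a mod 5 = j then fls_const (1 / fact a) * fls_X ^ j *
     (\<Prod>i<a div 5. fls_X ^ 5 - fls_const (k_O j i ^ 5)) else 0)"
proof (cases "a mod 5 = j")
  case True
  have inj: "inj_on (\<lambda>i. of_nat i + of_nat (a mod 5) / 5 :: rat) {..<a div 5}"
    by (auto intro: inj_onI)
  have k: "of_rat (of_nat i + of_nat (a mod 5) / 5) = fls_const (k_O j i)" for i
    by (simp add: k_O_def True of_rat_add of_rat_divide fls_of_nat fls_const_divide_const[symmetric]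
        fls_plus_const[symmetric])
  have X: "fls_X ^ a = fls_X ^ j * (\<Prod>i<a div 5. fls_X ^ 5 :: complex fls)"
  proof -
    have "fls_X ^ (j + 5 * (a div 5)) = fls_X ^ j * (\<Prod>i<a div 5. fls_X ^ 5 :: complex fls)"
      by (simp only: power_add power_mult prod_constant card_lessThan)
    moreover have "j + 5 * (a div 5) = a" using True by presburger
    ultimately show ?thesis by simp
  qed
  have z: "z_O ^ n * fls_X ^ n = 1" for n
  proof -
    have "z_O * fls_X = 1" by (simp add: z_O_def)
    then show ?thesis by (simp only: power_mult_distrib[symmetric] power_one)
  qed
  have f: "fact a = (fls_const (fact a) :: complex fls)"
    using fls_of_nat[of "fact a", where 'a = complex] by (simp only: of_nat_fact)
  have fac: "fls_X ^ 5 * (1 - (fls_const (k_O j i) * z_O) ^ 5) = fls_X ^ 5 - fls_const (k_O j i ^ 5)" for i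
  proof -
    have "fls_X ^ 5 * (1 - (fls_const (k_O j i) * z_O) ^ 5) =
        fls_X ^ 5 - fls_const (k_O j i) ^ 5 * (z_O ^ 5 * fls_X ^ 5)"
      by (simp only: power_mult_distrib right_diff_distrib mult_1_left mult_1_right mult_ac)
    then show ?thesis
      unfolding z by (simp add: fls_const_power)
  qed
  have "fps_nth (I_O j) a = 1 / (z_O ^ a * fact a) * (\<Prod>i<a div 5. 1 - (fls_const (k_O j i) * z_O) ^ 5)"
    unfolding I_O_def fps_nth_Abs_fps orbifold_index_set prod.reindex[OF inj] o_def k
    using True by simp
  also have "1 / (z_O ^ a * fact a) = fls_const (1 / fact a) * fls_X ^ a"
  proof -
    have "(z_O ^ a * fact a) * (fls_const (1 / fact a) * fls_X ^ a) =
        (fls_const (fact a) * fls_const (1 / fact a)) * (z_O ^ a * fls_X ^ a)"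
      by (simp only: f mult_ac)
    also have "\<dots> = 1"
      unfolding z by simp
    finally show ?thesis
      by (simp only: inverse_unique inverse_eq_divide[symmetric])
  qed
  also have "\<dots> * (\<Prod>i<a div 5. 1 - (fls_const (k_O j i) * z_O) ^ 5) = fls_const (1 / fact a) * fls_X ^ j *
      (\<Prod>i<a div 5. fls_X ^ 5 * (1 - (fls_const (k_O j i) * z_O) ^ 5))"
    unfolding X prod.distrib by (simp add: mult_ac)
  finally show ?thesis
    unfolding fac using True by simp
qed (simp add: I_O_def)

lemma lead_prod_O: "lead 1 0 (\<Prod>i<m. - (k_O j i ^ 5)) (\<Prod>i<m. fls_X ^ 5 - fls_const (k_O j i ^ 5))"
proof (induction m)
  case 0
  show ?case by (simp add: lead_1)
next
  case (Suc m)
  have "lead 1 0 (- (k_O j m ^ 5)) (fls_X ^ 5 - fls_const (k_O j m ^ 5))"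
    by (auto simp: lead_def)
  from lead_mult0[OF _ Suc this] show ?case by simp
qed

text \<open>For a positive multiple \<open>a\<close> of 5, the index \<open>k = 0\<close>
  contributes a factor \<open>u^5\<close>, which vanishes at \<open>u = 0\<close>.\<close>

lemma C_O_0: "at_infinity_O (F_O 0 0) = 1"
proof (rule fps_ext)
  fix a
  show "fps_nth (at_infinity_O (F_O 0 0)) a = fps_nth 1 a"
  proof (cases "a > 0 \<and> a mod 5 = 0")
    case True
    then have "a div 5 > 0" by auto
    then have "(\<Prod>i<a div 5. - (k_O 0 i ^ 5)) = 0"
      by (auto simp: prod_zero_iff k_O_def intro!: bexI[of _ 0])
    then show ?thesis
      using True lead_prod_O[of 0 "a div 5"] by (simp add: at_infinity_O_def I_O_nth lead_def)
  qed (auto simp: at_infinity_O_def I_O_nth)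
qed

lemma F_O_1_nth:
  "fps_nth (F_O 1 j) a = inverse fls_X * (of_nat a * fps_nth (I_O j) a)"
  using C_O_0 by (simp add: coeffwise_const_1 D_fps_nth z_O_def)

text \<open>For \<open>j\<close> from 1 to 4, the coefficient of the lowest power
  \<open>u^(j - 1)\<close> in component \<open>j\<close> of \<open>F_1\<close>. These are solutions
  of the Picard-Fuchs equation starting with \<open>\<psi>^j\<close>.\<close>

definition e_O :: "nat \<Rightarrow> complex fps" where
  "e_O j = Abs_fps (\<lambda>a. if a mod 5 = j then of_nat a / fact a * (\<Prod>i<a div 5. - (k_O j i ^ 5)) else 0)"

lemma F_O_1_coeff:
  "coeffwise (\<lambda>f. fls_nth f (int j)) (F_O 1 (Suc j)) = e_O (Suc j)"
proof (rule fps_ext)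
  fix a
  let ?p = "\<Prod>i<a div 5. fls_X ^ 5 - fls_const (k_O (Suc j) i ^ 5) :: complex fls"
  have "inverse fls_X * (of_nat a * (fls_const (1 / fact a) * fls_X ^ Suc j * ?p)) =
      fls_const (of_nat a / fact a) * (fls_X ^ j * ?p)"
  proof -
    have "inverse fls_X * (of_nat a * (fls_const (1 / fact a) * fls_X ^ Suc j * ?p)) =
        (of_nat a * fls_const (1 / fact a)) * ((inverse fls_X * fls_X) * (fls_X ^ j * ?p))"
      by (simp only: power_Suc mult_ac)
    then show ?thesis by (simp add: fls_of_nat)
  qed
  moreover have "fls_nth (fls_X ^ j * ?p) (int j) = (\<Prod>i<a div 5. - (k_O (Suc j) i ^ 5))"
    using lead_prod_O[of "Suc j" "a div 5"] by (simp add: fls_X_power_times_conv_shift lead_def)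
  ultimately have "fls_nth (inverse fls_X * (of_nat a * (fls_const (1 / fact a) * fls_X ^ Suc j * ?p))) (int j)
      = of_nat a / fact a * (\<Prod>i<a div 5. - (k_O (Suc j) i ^ 5))"
    by (simp only: fls_mult_const_nth)
  then show "fps_nth (coeffwise (\<lambda>f. fls_nth f (int j)) (F_O 1 (Suc j))) a = fps_nth (e_O (Suc j)) a"
    unfolding coeffwise_nth F_O_1_nth I_O_nth e_O_def by (cases "a mod 5 = Suc j") simp_all
qed

text \<open>The new factor of the product has index \<open>k_O j (a div 5) = a / 5\<close>. Of its
  five factors \<open>a\<close>, one is the \<open>a\<close> in the coefficient of index
  \<open>a\<close> itself; \<open>a + 5\<close> cancels against the factorial.\<close>

lemma e_O_rec:
  assumes "j < 5"
  shows "5 ^ 5 * (of_nat a + 1) * (of_nat a + 2) * (of_nat a + 3) * (of_nat a + 4) * fps_nth (e_O j) (5 + a)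
    = - (of_nat a ^ 4) * fps_nth (e_O j) a"
proof (cases "a mod 5 = j")
  case True
  let ?a = "of_nat a :: complex"
  have "5 * (a div 5) + j = a" using True by presburger
  then have "5 * of_nat (a div 5) + of_nat j = ?a"
    by (metis of_nat_add of_nat_mult of_nat_numeral)
  then have k: "k_O j (a div 5) = ?a / 5"
    by (simp add: k_O_def field_simps)
  define P where "P = (\<Prod>i<a div 5. - (k_O j i ^ 5))"
  define F where "F = (fact a :: complex)"
  have F: "F \<noteq> 0" by (simp add: F_def)
  have "5 + a = Suc (Suc (Suc (Suc (Suc a))))" by simp
  then have fact: "fact (5 + a) = (?a + 5) * ((?a + 4) * ((?a + 3) * ((?a + 2) * ((?a + 1) * F))))"
    by (simp only: fact_Suc F_def) (simp add: algebra_simps)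
  have "?a + of_nat k \<noteq> 0" if "k > 0" for k
    using that by (simp flip: of_nat_add)
  from this[of 1] this[of 2] this[of 3] this[of 4] this[of 5]
  have nz: "?a + 5 \<noteq> 0" "?a + 4 \<noteq> 0" "?a + 3 \<noteq> 0" "?a + 2 \<noteq> 0" "?a + 1 \<noteq> 0"
    by simp_all
  have alg: "5 ^ 5 * b1 * b2 * b3 * b4 * (b5 / (b5 * (b4 * (b3 * (b2 * (b1 * F'))))) * (P' * - ((a' / 5) ^ 5))) =
      - (a' ^ 4) * (a' / F' * P')"
    if "b5 \<noteq> 0" "b4 \<noteq> 0" "b3 \<noteq> 0" "b2 \<noteq> 0" "b1 \<noteq> 0" "F' \<noteq> 0"
    for b1 b2 b3 b4 b5 F' P' a' :: complex
    using that by (simp add: power_divide) (simp add: eval_nat_numeral)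
  have "fps_nth (e_O j) (5 + a) = of_nat (5 + a) / fact (5 + a) * (\<Prod>i<Suc (a div 5). - (k_O j i ^ 5))"
    using True by (simp add: e_O_def)
  also have "\<dots> = (?a + 5) / fact (5 + a) * (P * - ((?a / 5) ^ 5))"
    by (simp add: P_def k)
  finally have e5: "fps_nth (e_O j) (5 + a) = (?a + 5) / fact (5 + a) * (P * - ((?a / 5) ^ 5))" .
  have e0: "fps_nth (e_O j) a = ?a / F * P"
    using True by (simp add: e_O_def P_def F_def)
  show ?thesis
    unfolding e5 e0 fact by (rule alg[OF nz F])
next
  case False
  then show ?thesis by (simp add: e_O_def)
qed

lemma e_O_small:
  assumes "j < 5" "a < 5"
  shows "fps_nth (e_O j) a = (if a = j then of_nat j / fact j else 0)"
  using assms by (simp add: e_O_def)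

text \<open>The recursion covers the coefficients from index 5 on; below that the only nonzero one
  has index \<open>j\<close>, a root of \<open>(1 - n) (2 - n) (3 - n) (4 - n)\<close>. With
  \<open>z = \<psi>^5 / 5^5\<close>, the relation \<open>l_O^5 = z (1 - l_O^5)\<close> brings in
  \<open>L_op\<close>.\<close>

lemma L_op_O:
  assumes j: "0 < j" "j < 5"
  shows "Dm.L_op (l_O ^ 5) (fps_to_fls (e_O j)) = 0"
proof -
  define u where "u = fps_to_fls (e_O j)"
  let ?d = "\<lambda>f. - D f"
  let ?P = "\<lambda>u. ?d (?d (?d (?d u))) + 10 * ?d (?d (?d u)) + 35 * ?d (?d u) + 50 * ?d u + 24 * u"
  let ?z = "fls_const (1 / 5 ^ 5) * fls_X ^ 5 :: complex fls"
  have num: "fls_nth (numeral k * f) n = numeral k * fls_nth f n" for k n and f :: "complex fls"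
    by (simp flip: fls_const_numeral)
  have P: "fls_nth (?P u) n = (1 - of_int n) * (2 - of_int n) * (3 - of_int n) * (4 - of_int n) * fls_nth u n" for n
    by (simp add: num algebra_simps)
  have X: "fls_nth (?z * f) n = 1 / 5 ^ 5 * fls_nth f (n - 5)" for f :: "complex fls" and n
    unfolding mult.assoc fls_mult_const_nth by (simp add: fls_X_power_times_conv_shift)
  have eq: "?z * ?d (?d (?d (?d u))) + ?P u = 0"
  proof (rule fls_eqI)
    fix n :: int
    consider "n < 0" | a where "a < 5" "n = int a" | a where "n = 5 + int a"
      by (metis add_diff_cancel_left' diff_add_cancel int_nat_eq le_add_diff_inverse not_le of_nat_less_iff of_nat_numeral zle_iff_zadd add.commute)
    then have "1 / 5 ^ 5 * fls_nth (?d (?d (?d (?d u)))) (n - 5) + fls_nth (?P u) n = 0"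
    proof cases
      case 1
      then show ?thesis unfolding P by (simp add: u_def)
    next
      case 2
      then have "a = 0 \<or> a = 1 \<or> a = 2 \<or> a = 3 \<or> a = 4" by auto
      then show ?thesis
        unfolding P using 2 j by (auto simp: u_def e_O_small)
    next
      case 3
      have "5 ^ 5 * (1 / 5 ^ 5 * fls_nth (?d (?d (?d (?d u)))) (n - 5) + fls_nth (?P u) n) =
         of_nat a ^ 4 * fps_nth (e_O j) a + 5 ^ 5 * (of_nat a + 1) * (of_nat a + 2) * (of_nat a + 3) * (of_nat a + 4) * fps_nth (e_O j) (5 + a)"
        unfolding P using 3 by (simp add: u_def nat_add_distrib) (simp add: eval_nat_numeral algebra_simps)
      also have "\<dots> = 0"
        unfolding e_O_rec[OF j(2)] by simp
      finally show ?thesis by (simp only: mult_eq_0_iff) simp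
    qed
    then show "fls_nth (?z * ?d (?d (?d (?d u))) + ?P u) n = fls_nth 0 n"
      by (simp only: fls_plus_nth X fls_zero_nth)
  qed
  have "Dm.L_op (l_O ^ 5) u = l_O ^ 5 * ?d (?d (?d (?d u))) + (1 - l_O ^ 5) * ?P u"
    unfolding Dm.L_op_def by (simp add: algebra_simps)
  also have "\<dots> = (1 - l_O ^ 5) * (?z * ?d (?d (?d (?d u))) + ?P u)"
    by (subst l_O_props(2)) (simp only: distrib_left mult_ac)
  finally show ?thesis
    unfolding eq mult_zero_right unfolding u_def .
qed

lemma at_infinity_O_1: "at_infinity_O (F_O 1 1) = e_O 1"
  using F_O_1_coeff[of 0] by (simp add: at_infinity_O_def del: F_O.simps)

lemma C_O_1: "C_O 1 = fps_to_fls (e_O 1)"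
  using at_infinity_O_1 by (simp add: C_O_def del: F_O.simps)

lemma C_O_2: "C_O 2 = D (fps_to_fls (e_O 2) / fps_to_fls (e_O 1))"
proof -
  have "F_O 2 2 = fps_const z_O * D_fps (F_O 1 2 / coeffwise fls_const (at_infinity_O (F_O 1 1)))"
    unfolding numeral_2_eq_2 by (simp del: F_O.simps add: F_O.simps(2)[of "Suc 0"])
  then have "C_O 2 = D (fps_to_fls (coeffwise (\<lambda>f. fls_nth f 1) (F_O 1 2 / coeffwise fls_const (e_O 1))))"
    unfolding at_infinity_O_1
    by (simp add: C_O_def at_infinity_O_def z_O_def coeffwise_shift_D D_fps_to_fls del: F_O.simps)
  also have "fps_to_fls (coeffwise (\<lambda>f. fls_nth f 1) (F_O 1 2 / coeffwise fls_const (e_O 1)))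
     = fps_to_fls (coeffwise (\<lambda>f. fls_nth f 1) (F_O 1 2)) / fps_to_fls (e_O 1)"
  proof (rule coeffwise_divide_const)
    show "fps_nth (e_O 1) 1 \<noteq> 0"
      by (simp add: e_O_small)
    show "fps_nth (F_O 1 2) n = 0" if "n < 1" for n
      using that unfolding F_O_1_nth by simp
  qed
  also have "coeffwise (\<lambda>f. fls_nth f 1) (F_O 1 2) = e_O 2"
    using F_O_1_coeff[of 1] by (simp add: numeral_2_eq_2 del: F_O.simps)
  finally show ?thesis .
qed

lemma lead_mult3:
  assumes "p \<ge> 0" "lead p 1 a f" "lead p 1 b g" "lead p 1 c h"
  shows "lead p 3 (a * b * c) (f * g * h)"
  using lead_mult[OF assms(1) lead_mult[OF assms(1-3)] assms(4)] by simp

text \<open>Only exponents congruent to \<open>j\<close> modulo 5 occur, so the next term is five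
  orders higher.\<close>

lemma lead_e_O:
  assumes j: "j < 5"
  shows "lead 5 (int j) (of_nat j / fact j) (fps_to_fls (e_O j))"
  unfolding lead_def
proof (intro allI impI)
  fix n :: int assume n: "n < int j + 5"
  show "fls_nth (fps_to_fls (e_O j)) n = (if n = int j then of_nat j / fact j else 0)"
  proof (cases "n < 0")
    case False
    then obtain m where m: "n = int m"
      by (metis nonneg_int_cases not_less)
    then have "m mod 5 = j \<longleftrightarrow> m = j"
      using n j by presburger
    then show ?thesis
      using j by (simp add: m e_O_def)
  qed simp
qed

lemma relations_O:
  defines "d \<equiv> \<lambda>f. - D f" and "x \<equiv> - X_O" and "y \<equiv> - Y_O" and "L \<equiv> l_O ^ 5"
  shows "d (d (d x)) = - (4 * x * d (d x) + 3 * d x * d x + 6 * x * x * d x + x ^ 4)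
      - (1 - L) * (10 * (d (d x) + 3 * x * d x + x ^ 3) + 35 * (d x + x * x) + 50 * x + 24)"
    and "d y = - 4 * d x - 2 * x * x - 2 * x * y - y * y - 5 * (1 - L) * (2 * x + y + 2)"
    and "lead 5 0 (- 1) x" and "lead 5 0 (- 1) y"
proof -
  define u where "u = fps_to_fls (e_O 1)"
  define g where "g = fps_to_fls (e_O 2)"
  define t where "t = d (g / u)"
  have lu: "lead 5 1 1 u" and lg: "lead 5 2 1 g"
    using lead_e_O[of 1] lead_e_O[of 2] by (simp_all add: u_def g_def)
  have u0: "u \<noteq> 0"
    using lead_nonzero[OF _ lu] by simp
  have t: "t = - C_O 2"
    by (simp add: t_def u_def g_def C_O_2 d_def)
  have ld: "lead 5 k (- of_int k * c) (d f)" if "lead 5 k c f" for k c f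
    using lead_uminus[OF lead_D[OF that]] by (simp add: d_def)
  have du: "lead 5 1 (- 1) (d u)" "lead 5 1 1 (d (d u))"
    using ld[OF lu] ld[OF ld[OF lu]] by simp_all
  have lr: "lead 5 1 1 (g / u)"
    using lead_divide[OF _ lu _ lg] by simp
  have lt: "lead 5 1 (- 1) t" "lead 5 1 1 (d t)" "lead 5 1 (- 1) (d (d t))"
    using ld[OF lr] ld[OF ld[OF lr]] ld[OF ld[OF ld[OF lr]]] by (simp_all add: t_def)
  have t0: "t \<noteq> 0"
    using lead_nonzero[OF _ lt(1)] by simp
  have L0: "lead 5 0 0 L"
  proof -
    have "val 1 l_O"
      using lead_val[OF _ l_O_props(3)] by simp
    then have "val (int n) (l_O ^ n)" for n
    proof (induction n)
      case 0
      show ?case by (simp add: val_def)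
    next
      case (Suc n)
      then show ?case
        using val_mult[of 1 l_O "int n" "l_O ^ n"] \<open>val 1 l_O\<close> by (simp add: add.commute)
    qed
    from this[of 5] show ?thesis by (simp add: L_def val_def lead_def)
  qed
  have dL: "d L = 5 * L * (L - 1)"
    unfolding L_def d_def by (rule Dm.d_power5[OF l_O_props(1)])
  have op: "Dm.L_op L u = 0" "Dm.L_op L (u * (g / u)) + 0 * Dm.L_op' L u = 0"
    using L_op_O[of 1] L_op_O[of 2] u0 by (simp_all add: L_def u_def g_def)
  have "Dm.S_form L u t = 0"
  proof (rule D_eq_mult_imp_zero)
    have "- D (Dm.S_form L u t) = - 5 * (1 - L) * Dm.S_form L u t"
      using Dm.d_S_form[OF dL[unfolded d_def] op] by (simp add: t_def d_def Dm.d_0)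
    then show "D (Dm.S_form L u t) = (5 * (1 - L)) * Dm.S_form L u t"
      by (simp only: mult_minus_left neg_equal_iff_equal)
    show "lead 1 0 (of_int 5) (5 * (1 - L))"
    proof (rule lead_cong)
      have "lead 1 0 0 L" using L0 by (simp add: lead_def)
      then show "lead 1 0 (5 * (1 - 0)) (5 * (1 - L))"
        by (intro lead_mult0 lead_numeral lead_diff lead_1) auto
    qed simp
    have S: "Dm.S_form L u t = - 2 * (d u * d u * t) + 4 * (u * d (d u) * t) + 2 * (u * d u * d t) + (u * u * d (d t))
       + 5 * ((1 - L) * (2 * (u * d u * t) + (u * u * d t))) + 10 * ((1 - L) * (u * u * t))"
      unfolding Dm.S_form_def d_def by (simp add: algebra_simps)
    have m2: "lead 5 0 (- 2) (- 2)" using lead_const[of 5 "- 2"] by simp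
    \<comment> \<open>Since \<open>L = 0\<close> at \<open>\<psi> = 0\<close>, the exponent is 5 and
      the coefficient of \<open>\<psi>^5\<close> has to vanish. The terms of order 3 cancel,
      \<open>2 - 4 - 2 - 1 + 15 - 10 = 0\<close>, and precision 5 excludes all further terms below
      order 8.\<close>
    have "lead 5 3 0 (Dm.S_form L u t)"
      unfolding S
      by (rule lead_cong, (rule lead_add lead_mult0 m2 lead_mult3 lead_numeral lead_diff[OF lead_1 L0] lu lt du | simp)+)
    then show "fls_nth (Dm.S_form L u t) 5 = 0"
      by (simp add: lead_def)
  qed
  moreover have dux: "- D u = x * u"
    unfolding x_def X_O_def C_O_1 u_def[symmetric] using u0 by simp
  moreover have dty: "- D t = y * t"
    using t0 unfolding y_def Y_O_def t by (simp add: D.d_simps)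
  ultimately show "d y = - 4 * d x - 2 * x * x - 2 * x * y - y * y - 5 * (1 - L) * (2 * x + y + 2)"
    unfolding d_def using Dm.relation_y u0 t0 by blast
  show "d (d (d x)) = - (4 * x * d (d x) + 3 * d x * d x + 6 * x * x * d x + x ^ 4)
      - (1 - L) * (10 * (d (d x) + 3 * x * d x + x ^ 3) + 35 * (d x + x * x) + 50 * x + 24)"
    unfolding d_def using Dm.relation_x[OF op(1) dux u0] .
  have "x = d u / u" "y = d t / t"
    using dux dty u0 t0 by (simp_all add: d_def field_simps)
  then show "lead 5 0 (- 1) x" "lead 5 0 (- 1) y"
    using lead_divide[OF _ lu _ du(1)] lead_divide[OF _ lt(1) _ lt(2)] by simp_all
qed

section \<open>The derivation and the weight filtration on the ring\<close>

lemma ev_K_hom: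
  "ev_K (f + g) = ev_K f + ev_K g" "ev_K (f * g) = ev_K f * ev_K g" "ev_K (f - g) = ev_K f - ev_K g"
  "ev_K (- f) = - ev_K f" "ev_K 0 = 0" "ev_K 1 = 1" "ev_K (numeral n) = numeral n"
  "ev_K (f ^ k) = ev_K f ^ k" "ev_K (cc c) = fls_const c"
  "ev_K vL = L_K" "ev_K vL' = inverse L_K" "ev_K vX = X_K" "ev_K vX1 = D X_K" "ev_K vX2 = D (D X_K)"
  "ev_K vY = Y_K"
  by (simp_all only: ev_K_eq subst_FF_hom L_K_props not_False_eq_True)

lemma ev_T_hom:
  "ev_T (f + g) = ev_T f + ev_T g" "ev_T (f * g) = ev_T f * ev_T g" "ev_T (f - g) = ev_T f - ev_T g"
  "ev_T (- f) = - ev_T f" "ev_T 0 = 0" "ev_T 1 = 1" "ev_T (numeral n) = numeral n"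
  "ev_T (f ^ k) = ev_T f ^ k" "ev_T (cc c) = fls_const c"
  "ev_T vL = l_O" "ev_T vL' = inverse l_O" "ev_T vX = - X_O / 5" "ev_T vX1 = D X_O / 25"
  "ev_T vX2 = - D (D X_O) / 125" "ev_T vY = - Y_O / 5"
  by (simp_all only: ev_T_def l_O_def[symmetric] subst_FF_hom l_O_props not_False_eq_True)

lemma fls_X_div_5_nonzero: "fls_X / 5 \<noteq> (0 :: complex fls)"
  by simp

lemma ev_p_hom:
  "ev_p (f + g) = ev_p f + ev_p g" "ev_p (f * g) = ev_p f * ev_p g" "ev_p (f - g) = ev_p f - ev_p g"
  "ev_p (- f) = - ev_p f" "ev_p 0 = 0" "ev_p 1 = 1" "ev_p (numeral n) = numeral n"
  "ev_p (f ^ k) = ev_p f ^ k" "ev_p (cc c) = fls_const c"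
  "ev_p vL = fls_X / 5" "ev_p vL' = inverse (fls_X / 5)" "ev_p vX = - 1 / 5" "ev_p vX1 = 0"
  "ev_p vX2 = 0" "ev_p vY = - 1 / 5"
  by (simp_all only: ev_p_def subst_FF_hom fls_X_div_5_nonzero not_False_eq_True)

text \<open>\<open>5 * vX\<close>, \<open>25 * vX1\<close>, \<open>125 * vX2\<close>,
  \<open>5 * vY\<close> stand for \<open>x\<close>, \<open>\<theta> x\<close>,
  \<open>\<theta>^2 x\<close>, \<open>y\<close>. Then \<open>qX\<close> is
  \<open>(10 \<theta>^3 + 35 \<theta>^2 + 50 \<theta> + 24) u / u\<close>, and \<open>rX\<close>,
  \<open>rY\<close> represent \<open>\<theta>^3 x\<close> and \<open>\<theta> y\<close>.\<close>

definition qX :: FF where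
  "qX = 10 * (125 * vX2 + 3 * (5 * vX) * (25 * vX1) + (5 * vX) ^ 3)
     + 35 * (25 * vX1 + (5 * vX) * (5 * vX)) + 50 * (5 * vX) + 24"

definition rX :: FF where
  "rX = - (4 * (5 * vX) * (125 * vX2) + 3 * (25 * vX1) * (25 * vX1)
       + 6 * (5 * vX) * (5 * vX) * (25 * vX1) + (5 * vX) ^ 4) - (1 - vL ^ 5) * qX"

definition rY :: FF where
  "rY = - 4 * (25 * vX1) - 2 * (5 * vX) * (5 * vX) - 2 * (5 * vX) * (5 * vY) - (5 * vY) * (5 * vY)
     - 5 * (1 - vL ^ 5) * (2 * (5 * vX) + (5 * vY) + 2)"

lemma ev_K_r: "ev_K rX = 5 * D (5 * D (5 * D (5 * X_K)))" "ev_K rY = 5 * D (5 * Y_K)"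
proof -
  have x: "5 * D (5 * X_K) = 25 * D X_K" "5 * D (25 * D X_K) = 125 * D (D X_K)"
    by (simp_all add: D.d_simps)
  show "ev_K rX = 5 * D (5 * D (5 * D (5 * X_K)))"
    using relations_K(1) unfolding rX_def qX_def ev_K_hom by (simp only: x)
  show "ev_K rY = 5 * D (5 * Y_K)"
    using relations_K(2) unfolding rY_def ev_K_hom by (simp only: x)
qed

lemma ev_T_r: "ev_T rX = - D (- D (- D (- X_O)))" "ev_T rY = - D (- Y_O)"
proof -
  have x: "5 * (- X_O / 5) = - X_O" "25 * (D X_O / 25) = - D (- X_O)"
    "125 * (- D (D X_O) / 125) = - D (- D (- X_O))" "5 * (- Y_O / 5) = - Y_O"
    by (simp_all add: D.d_simps)
  show "ev_T rX = - D (- D (- D (- X_O)))"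
    using relations_O(1) unfolding rX_def qX_def ev_T_hom x by (simp only:)
  show "ev_T rY = - D (- Y_O)"
    using relations_O(2) unfolding rY_def ev_T_hom x by (simp only:)
qed

lemma cc_numeral_inverse: "numeral n * cc (1 / numeral n) = 1"
  by (simp add: mult_single flip: single_numeral single_one)

lemma D_inverse: "D (inverse f) = - D f * inverse f * inverse f" if "f \<noteq> 0"
proof -
  have "D (f * inverse f) = 0"
    using that by (simp add: D.d_1)
  then have "f * D (inverse f) = - D f * inverse f"
    by (simp add: D_mult add_eq_0_iff)
  then have "(inverse f * f) * D (inverse f) = inverse f * (- D f * inverse f)"
    by (simp only: mult.assoc)
  then show ?thesis
    using that by (simp add: mult_ac)
qed

lemma D_scale: "D (fls_const c * f) = fls_const c * D f"
  by (simp add: D_mult D_const)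

lemma numeral_times_fls_const: "numeral n * fls_const c = fls_const (numeral n * c :: complex)"
  by (simp flip: fls_const_numeral)

text \<open>One and the same \<open>g\<close> serves both evaluations, so \<open>T\<close> carries
  \<open>5 * D\<close> to \<open>- D\<close>. For \<open>vX2\<close> and \<open>vY\<close> this
  rests on the differential relations, which are the same polynomials on both sides; the Leibniz
  rule extends it to products.\<close>

lemma ex_derivative: "\<exists>g. ev_K g = 5 * D (ev_K f) \<and> ev_T g = - D (ev_T f)"
proof (induction f rule: FF_induct)
  case (const c)
  show ?case by (intro exI[of _ 0]) (simp add: ev_K_hom ev_T_hom D_const)
next
  case L
  show ?case
    by (intro exI[of _ "vL * (vL ^ 5 - 1)"]) (simp only: ev_K_hom ev_T_hom L_K_props(1) l_O_props(1))
next
  case L'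
  have "5 * D (inverse L_K) = - inverse L_K * (L_K ^ 5 - 1)"
  proof -
    have "5 * D (inverse L_K) = - (5 * D L_K) * inverse L_K * inverse L_K"
      using L_K_props(4) by (simp add: D_inverse)
    then show ?thesis unfolding L_K_props(1) using L_K_props(4) by simp
  qed
  moreover have "- D (inverse l_O) = - inverse l_O * (l_O ^ 5 - 1)"
  proof -
    have "- D (inverse l_O) = - (- D l_O) * inverse l_O * inverse l_O"
      using l_O_props(4) by (simp add: D_inverse)
    then show ?thesis unfolding l_O_props(1) using l_O_props(4) by simp
  qed
  ultimately show ?case
    by (intro exI[of _ "- vL' * (vL ^ 5 - 1)"]) (simp only: ev_K_hom ev_T_hom)
next
  case X
  show ?case
    by (intro exI[of _ "5 * vX1"]) (simp add: ev_K_hom ev_T_hom fls_divide_numeral D_scale D.d_uminus numeral_times_fls_const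
          mult.assoc[symmetric])
next
  case X1
  show ?case
    by (intro exI[of _ "5 * vX2"]) (simp add: ev_K_hom ev_T_hom fls_divide_numeral D_scale D.d_uminus numeral_times_fls_const
          mult.assoc[symmetric])
next
  case X2
  have i: "numeral n * fls_const (1 / numeral n) = (1 :: complex fls)" for n
    using fls_divide_numeral[of "numeral n" n] by (simp add: mult.commute)
  have "ev_K (cc (1/125) * rX) = (125 * fls_const (1/125)) * (5 * D (D (D X_K)))"
    by (simp add: ev_K_hom ev_K_r D.d_simps)
  moreover have "ev_T (cc (1/125) * rX) = - D (- D (D X_O) / 125)"
    by (simp add: ev_T_hom ev_T_r fls_divide_numeral D_scale D.d_uminus)
  ultimately show ?case
    by (intro exI[of _ "cc (1/125) * rX"]) (simp only: i ev_K_hom ev_T_hom mult_1)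
next
  case Y
  have i: "numeral n * fls_const (1 / numeral n) = (1 :: complex fls)" for n
    using fls_divide_numeral[of "numeral n" n] by (simp add: mult.commute)
  have "ev_K (cc (1/5) * rY) = (5 * fls_const (1/5)) * (5 * D Y_K)"
    by (simp add: ev_K_hom ev_K_r D.d_simps)
  moreover have "ev_T (cc (1/5) * rY) = - D (- Y_O / 5)"
    by (simp add: ev_T_hom ev_T_r fls_divide_numeral D_scale D.d_uminus)
  ultimately show ?case
    by (intro exI[of _ "cc (1/5) * rY"]) (simp only: i ev_K_hom ev_T_hom mult_1)
next
  case (add f g)
  then obtain f' g' where "ev_K f' = 5 * D (ev_K f) \<and> ev_T f' = - D (ev_T f)"
    "ev_K g' = 5 * D (ev_K g) \<and> ev_T g' = - D (ev_T g)" by blast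
  then show ?case
    by (intro exI[of _ "f' + g'"]) (simp add: ev_K_hom ev_T_hom D_add algebra_simps)
next
  case (mult f g)
  then obtain f' g' where "ev_K f' = 5 * D (ev_K f) \<and> ev_T f' = - D (ev_T f)"
    "ev_K g' = 5 * D (ev_K g) \<and> ev_T g' = - D (ev_T g)" by blast
  then show ?case
    by (intro exI[of _ "f' * g + f * g'"]) (simp add: ev_K_hom ev_T_hom D_mult algebra_simps)
qed

text \<open>The derivation \<open>5 * D\<close> lifted to the polynomial ring. By
  \<open>ex_derivative\<close> the argument of \<open>inv ev_K\<close> lies in the range of
  \<open>ev_K\<close>; injectivity makes the lift unique.\<close>

definition dF :: "FF \<Rightarrow> FF" where
  "dF f = inv ev_K (5 * D (ev_K f))"

definition "xi2 = 5 * vX + 1"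
definition "xi3 = 25 * vX1 + (5 * vX + 2) * (5 * vX + 1)"
definition "xi4 = 125 * vX2 + 25 * vX1 * (5 * vX + 1) + (5 * vX + 2) * (25 * vX1) + (5 * vX + 3) * xi3"
definition "eta = 5 * vY + 1"

lemmas coord_defs = xi2_def xi3_def xi4_def eta_def

text \<open>\<open>xi2\<close>, \<open>xi3\<close>, \<open>xi4\<close> are \<open>(\<theta> + 1) u / u\<close>, \<open>(\<theta> + 2) (\<theta> + 1) u / u\<close> and
  \<open>(\<theta> + 3) (\<theta> + 2) (\<theta> + 1) u / u\<close> with \<open>X = \<theta> u / (5 u)\<close>. The local exponents \<open>-1, -2, -3, -4\<close>
  of the Picard-Fuchs operator at \<open>L = 0\<close> make \<open>\<theta>\<close> act on the generator of weight \<open>w\<close> as \<open>- w\<close>, up to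
  terms of higher weight.\<close>

inductive Fil :: "int \<Rightarrow> FF \<Rightarrow> bool" where
  const: "Fil 0 (cc c)"
| L: "Fil 1 vL"
| L': "Fil (- 1) vL'"
| xi2: "Fil 1 xi2"
| xi3: "Fil 2 xi3"
| xi4: "Fil 3 xi4"
| eta: "Fil 1 eta"
| add: "Fil w f \<Longrightarrow> Fil w g \<Longrightarrow> Fil w (f + g)"
| mult: "Fil w f \<Longrightarrow> Fil v g \<Longrightarrow> Fil (w + v) (f * g)"
| mono: "Fil (w + 1) f \<Longrightarrow> Fil w f"

lemma Fil_mono: "Fil v f \<Longrightarrow> w \<le> v \<Longrightarrow> Fil w f"
proof (induction "nat (v - w)" arbitrary: w)
  case (Suc n)
  then have "Fil (w + 1) f" by simp
  then show ?case by (rule Fil.mono)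
qed simp

lemma Fil_mult0: "Fil 0 f \<Longrightarrow> Fil w g \<Longrightarrow> Fil w (f * g)"
  using Fil.mult[of 0 f w g] by simp

lemma Fil_numeral: "Fil 0 (numeral n)"
  using Fil.const[of "numeral n"] by simp

lemma Fil_1: "Fil 0 1"
  using Fil.const[of 1] by simp

lemma Fil_0: "Fil w 0"
proof -
  have "Fil w 0" for w
  proof (cases "w \<le> 0")
    case True
    then show ?thesis using Fil_mono Fil.const[of 0] by fastforce
  next
    case False
    have "Fil (int n) (vL ^ n)" for n
      by (induction n) (use Fil_1 Fil.mult[OF Fil.L] in auto)
    from Fil.mult[OF Fil.const[of 0] this[of "nat w"]] False show ?thesis by simp
  qed
  then show ?thesis .
qed

lemma Fil_of_int: "Fil 0 (of_int k)"
  using Fil.const[of "of_int k"] by simp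

lemma Fil_uminus: "Fil w f \<Longrightarrow> Fil w (- f)"
  using Fil_mult0[OF Fil_of_int[of "- 1"], of w f] by simp

lemma Fil_diff: "Fil w f \<Longrightarrow> Fil w g \<Longrightarrow> Fil w (f - g)"
  using Fil.add[OF _ Fil_uminus] by fastforce

lemma Fil_power: "Fil 0 f \<Longrightarrow> Fil 0 (f ^ n)"
  by (induction n) (auto intro: Fil_1 Fil_mult0)

lemma Fil_L_power: "Fil (int n) (vL ^ n)"
  by (induction n) (use Fil_1 Fil.mult[OF Fil.L] in auto)

text \<open>The coordinates are triangular in the scaled generators, so these are recovered one
  after the other.\<close>

lemma Fil_gens: "Fil 0 (5 * vX)" "Fil 0 (25 * vX1)" "Fil 0 (125 * vX2)" "Fil 0 (5 * vY)"
proof -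
  have xi: "Fil 0 xi2" "Fil 0 xi3" "Fil 0 xi4" "Fil 0 eta"
    by (auto intro: Fil_mono Fil.intros)
  note I = xi Fil.add Fil_diff Fil_mult0 Fil_numeral Fil_1
  have "Fil 0 (xi2 - 1)" "Fil 0 (eta - 1)" by (intro I)+
  then show x: "Fil 0 (5 * vX)" and "Fil 0 (5 * vY)" by (simp_all add: coord_defs)
  have "Fil 0 (xi3 - (5 * vX + 2) * (5 * vX + 1))" by (intro I x)
  then show x1: "Fil 0 (25 * vX1)" by (simp add: coord_defs)
  have "Fil 0 (xi4 - 25 * vX1 * (5 * vX + 1) - (5 * vX + 2) * (25 * vX1) - (5 * vX + 3) * xi3)"
    by (intro I x x1)
  then show "Fil 0 (125 * vX2)" by (simp add: xi4_def)
qed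

lemma Fil_exists: "\<exists>w. Fil w f"
proof (induction f rule: FF_induct)
  have c: "Fil 0 f" if "Fil 0 (numeral n * f)" for n f
  proof -
    have "cc (1 / numeral n) * (numeral n * f) = (numeral n * cc (1 / numeral n)) * f"
      by (simp only: mult_ac)
    also have "\<dots> = f"
      by (simp only: cc_numeral_inverse mult_1)
    finally show ?thesis
      using Fil_mult0[OF Fil.const that, of "1 / numeral n"] by simp
  qed
  {
    case X
    show ?case using c Fil_gens by blast
  next
    case X1
    show ?case using c Fil_gens by blast
  next
    case X2
    show ?case using c Fil_gens by blast
  next
    case Y
    show ?case using c Fil_gens by blast
  }
next
  case (add f g)
  then obtain v w where "Fil v f" "Fil w g" by blast
  then have "Fil (min v w) f" "Fil (min v w) g" by (auto intro: Fil_mono)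
  then show ?case using Fil.add by blast
qed (blast intro: Fil.intros)+

text \<open>Under \<open>ev_T\<close> the elements \<open>xi2\<close>, \<open>xi3\<close>,
  \<open>xi4\<close>, \<open>eta\<close> vanish to order 5, since \<open>5 * vX\<close> and
  \<open>5 * vY\<close> become -1 up to that order; under \<open>ev_p\<close> they are 0. As their
  weights are at most 3, both coefficients are 0 for them; for \<open>vL\<close> both are 1/5.
  Agreement at order \<open>w\<close> is stable under sums and products.\<close>

lemma Fil_lead: "Fil w f \<Longrightarrow> \<exists>c. lead 1 w c (ev_T f) \<and> lead 1 w c (ev_p f)"
proof (induction rule: Fil.induct)
  case (const c)
  show ?case by (intro exI[of _ c]) (simp add: ev_T_hom ev_p_hom lead_const)
next
  case L
  have "lead 1 1 (1 / 5) (fls_X / 5)"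
    unfolding fls_divide_numeral by (simp add: lead_def)
  then show ?case
    using l_O_props(3) by (intro exI[of _ "1 / 5"]) (simp only: ev_T_hom ev_p_hom)
next
  case L'
  have X: "lead 1 1 (1 / 5) (fls_X / 5)"
    unfolding fls_divide_numeral by (simp add: lead_def)
  have "lead 1 (- 1) 5 (inverse f)" if "lead 1 1 (1 / 5) f" for f
    using lead_divide[OF _ that _ lead_1] by (simp add: inverse_eq_divide)
  then show ?case
    using l_O_props(3) X by (intro exI[of _ 5]) (simp only: ev_T_hom ev_p_hom)
next
  case (add w f g)
  then show ?case by (metis ev_T_hom(1) ev_p_hom(1) lead_add)
next
  case (mult w f v g)
  then obtain a b where "lead 1 w a (ev_T f)" "lead 1 w a (ev_p f)" "lead 1 v b (ev_T g)" "lead 1 v b (ev_p g)"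
    by blast
  then show ?case
    by (intro exI[of _ "a * b"]) (simp add: ev_T_hom ev_p_hom lead_mult)
next
  case (mono w f)
  then show ?case by (intro exI[of _ 0]) (auto simp: lead_def)
next
  have x: "lead 5 0 (- 1) (- X_O)" and y: "lead 5 0 (- 1) (- Y_O)"
    by (rule relations_O)+
  have d: "lead 5 0 0 (- D f)" if "lead 5 0 c f" for c f
    using lead_uminus[OF lead_D[OF that]] by simp
  have e: "5 * (- X_O / 5) = - X_O" "25 * (D X_O / 25) = - D (- X_O)"
    "125 * (- D (D X_O) / 125) = - D (- D (- X_O))" "5 * (- Y_O / 5) = - Y_O"
    by (simp_all add: D.d_simps)
  have p: "5 * (- 1 / 5) = (- 1 :: complex fls)"
    by simp
  note I = x y d[OF x] d[OF d[OF x]] lead_add lead_mult0 lead_numeral lead_1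
  have xi2: "lead 5 0 0 (ev_T xi2)"
    unfolding coord_defs ev_T_hom e by (rule lead_cong, (rule I | simp)+)
  have xi3: "lead 5 0 0 (ev_T xi3)"
    unfolding coord_defs ev_T_hom e by (rule lead_cong, (rule I | simp)+)
  have xi4: "lead 5 0 0 (ev_T xi4)"
    unfolding xi4_def ev_T_hom(1-3,6,7,10-) e by (rule lead_cong, (rule I xi3 | simp)+)
  have eta: "lead 5 0 0 (ev_T eta)"
    unfolding coord_defs ev_T_hom e by (rule lead_cong, (rule I | simp)+)
  have c: "lead 1 w 0 f" if "lead 5 0 0 f" "w < 4" for w f
    using that by (auto simp: lead_def)
  have z: "lead 1 w 0 0" for w
    by (simp add: lead_def)
  have p0: "ev_p xi2 = 0" "ev_p xi3 = 0" "ev_p xi4 = 0" "ev_p eta = 0"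
    unfolding coord_defs ev_p_hom p by simp_all
  {
    case xi2
    show ?case using c[OF \<open>lead 5 0 0 (ev_T xi2)\<close>] p0 z by (intro exI[of _ 0]) simp
  next
    case xi3
    show ?case using c[OF \<open>lead 5 0 0 (ev_T xi3)\<close>] p0 z by (intro exI[of _ 0]) simp
  next
    case xi4
    show ?case using c[OF \<open>lead 5 0 0 (ev_T xi4)\<close>] p0 z by (intro exI[of _ 0]) simp
  next
    case eta
    show ?case using c[OF \<open>lead 5 0 0 (ev_T eta)\<close>] p0 z by (intro exI[of _ 0]) simp
  }
qed

section \<open>Action of the derivation on the filtration\<close>

lemma ring_identity_xi3:
  fixes x x1 x2 :: "'a::comm_ring_1"
  shows "x2 + (x1 * (x + 1) + (x + 2) * x1) = - 2 * (x1 + (x + 2) * (x + 1))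
    + (x2 + x1 * (x + 1) + (x + 2) * x1 + (x + 3) * (x1 + (x + 2) * (x + 1)) - (x + 1) * (x1 + (x + 2) * (x + 1)))"
  by (simp add: algebra_simps)

lemma ring_identity_xi2:
  fixes x x1 :: "'a::comm_ring_1"
  shows "x1 = - (x + 1) + (x1 + (x + 2) * (x + 1) - (x + 1) * (x + 1))"
  by (simp add: algebra_simps)

text \<open>\<open>r\<close> is the value that the Picard-Fuchs equation gives to
  \<open>\<theta>^3 x\<close>; with it, \<open>(\<theta> + 1) (\<theta> + 2) (\<theta> + 3)
  (\<theta> + 4) u / u\<close> becomes \<open>L * q\<close>.\<close>

lemma ring_identity_xi4:
  fixes x x1 x2 L :: "'a::comm_ring_1"
  defines "a \<equiv> x1 + (x + 2) * (x + 1)"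
  defines "b \<equiv> x2 + x1 * (x + 1) + (x + 2) * x1 + (x + 3) * a"
  defines "q \<equiv> 10 * (x2 + 3 * x * x1 + x ^ 3) + 35 * (x1 + x * x) + 50 * x + 24"
  defines "r \<equiv> - (4 * x * x2 + 3 * x1 * x1 + 6 * x * x * x1 + x ^ 4) - (1 - L) * q"
  shows "r + (x2 * (x + 1) + x1 * x1) + (x1 * x1 + (x + 2) * x2) + (x1 * a + (x + 3) * (x2 + (x1 * (x + 1) + (x + 2) * x1)))
      = - 3 * b + (L * q - (x + 1) * b)"
  unfolding assms power4_eq_xxxx power3_eq_cube by (simp only: distrib_left distrib_right left_diff_distrib right_diff_distrib mult_minus_left mult_minus_right minus_add_distrib minus_diff_eq) (simp add: algebra_simps)

lemma ring_identity_eta: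
  fixes x x1 y L :: "'a::comm_ring_1"
  defines "a \<equiv> x1 + (x + 2) * (x + 1)"
  shows "- 4 * x1 - 2 * x * x - 2 * x * y - y * y - 5 * (1 - L) * (2 * x + y + 2) = 
   - (y + 1) + (- 4 * a + 2 * (x + 1) * (x + 1) - 2 * (x + 1) * (y + 1) - (y + 1) * (y + 1)
     + 5 * (L * (2 * x + y + 2)))"
  unfolding assms by (simp add: algebra_simps)
context
  assumes inj: "inj ev_K"
begin

lemma dF_unique: "ev_K g = 5 * D (ev_K f) \<Longrightarrow> dF f = g"
  unfolding dF_def by (metis inj inv_f_f)

lemma ev_K_dF: "ev_K (dF f) = 5 * D (ev_K f)"
  using ex_derivative[of f] dF_unique by metis

lemma ev_T_dF: "ev_T (dF f) = - D (ev_T f)"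
  using ex_derivative[of f] dF_unique by metis

lemma dF_add: "dF (f + g) = dF f + dF g"
  by (rule dF_unique) (simp add: ev_K_hom ev_K_dF D_add algebra_simps)

lemma dF_mult: "dF (f * g) = dF f * g + f * dF g"
  by (rule dF_unique) (simp add: ev_K_hom ev_K_dF D_mult algebra_simps)

lemma dF_const: "dF (cc c) = 0"
  by (rule dF_unique) (simp add: ev_K_hom D_const)

lemma dF_numeral: "dF (numeral n) = 0" "dF 1 = 0"
  using dF_const[of "numeral n"] dF_const[of 1] by simp_all

lemma dF_vL: "dF vL = vL * (vL ^ 5 - 1)"
  by (rule dF_unique) (simp only: ev_K_hom L_K_props(1))

lemma dF_vL': "dF vL' = - vL' * (vL ^ 5 - 1)"
proof -
  have "dF (vL * vL') = 0"
    using dF_const[of 1] by (simp add: vL_vL')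
  then have "vL * dF vL' = - dF vL * vL'"
    by (simp add: dF_mult add_eq_0_iff)
  then have "vL' * (vL * dF vL') = vL' * (- dF vL * vL')"
    by simp
  then have "(vL * vL') * dF vL' = - ((vL * vL') * (vL' * (vL ^ 5 - 1)))"
    unfolding dF_vL by (simp only: mult_ac mult_minus_left mult_minus_right)
  then show ?thesis
    by (simp add: vL_vL')
qed

lemma dF_gens:
  "dF (5 * vX) = 25 * vX1" "dF (25 * vX1) = 125 * vX2" "dF (125 * vX2) = rX" "dF (5 * vY) = rY"
proof -
  have D_num: "D (numeral n * f) = numeral n * D f" for n f
    by (simp only: D_mult D.d_numeral mult_zero_left add_0_left)
  have K: "5 * D (5 * X_K) = 25 * D X_K" "5 * D (25 * D X_K) = 125 * D (D X_K)"
    unfolding D_num by simp_all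
  have "ev_K (25 * vX1) = 5 * D (ev_K (5 * vX))" "ev_K (125 * vX2) = 5 * D (ev_K (25 * vX1))"
    unfolding ev_K_hom K by (rule refl)+
  then show "dF (5 * vX) = 25 * vX1" "dF (25 * vX1) = 125 * vX2"
    by (auto intro: dF_unique)
  have "ev_K rX = 5 * D (ev_K (125 * vX2))" "ev_K rY = 5 * D (ev_K (5 * vY))"
    unfolding ev_K_r ev_K_hom K by (rule refl)+
  then show "dF (125 * vX2) = rX" "dF (5 * vY) = rY"
    by (auto intro: dF_unique)
qed

text \<open>With \<open>x = 5 * vX\<close>, \<open>xi3 = (\<theta> + x + 2) xi2\<close>,
  \<open>xi4 = (\<theta> + x + 3) xi3\<close>, and \<open>(\<theta> + x + 4) xi4 = vL^5 qX\<close>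
  by the Picard-Fuchs equation. Writing \<open>x = xi2 - 1\<close> isolates the multiples -1, -2,
  -3.\<close>

lemma dF_coords:
  "dF xi2 = - xi2 + (xi3 - xi2 * xi2)"
  "dF xi3 = - 2 * xi3 + (xi4 - xi2 * xi3)"
  "dF xi4 = - 3 * xi4 + (vL ^ 5 * qX - xi2 * xi4)"
  "dF eta = - eta + (- 4 * xi3 + 2 * xi2 * xi2 - 2 * xi2 * eta - eta * eta
     + 5 * (vL ^ 5 * (2 * (5 * vX) + 5 * vY + 2)))"
proof -
  define x where "x = 5 * vX"
  define x1 where "x1 = 25 * vX1"
  define x2 where "x2 = 125 * vX2"
  define y where "y = 5 * vY"
  define L where "L = vL ^ 5"
  have d: "dF x = x1" "dF x1 = x2" "dF x2 = rX" "dF y = rY"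
    unfolding x_def x1_def x2_def y_def by (rule dF_gens)+
  note simps = dF_add dF_mult dF_numeral d add_0_right
  note folds = x_def[symmetric] x1_def[symmetric] x2_def[symmetric] y_def[symmetric] L_def[symmetric]
  show "dF xi2 = - xi2 + (xi3 - xi2 * xi2)"
    unfolding coord_defs folds simps by (rule ring_identity_xi2)
  show "dF xi3 = - 2 * xi3 + (xi4 - xi2 * xi3)"
    unfolding coord_defs folds simps by (rule ring_identity_xi3)
  show "dF xi4 = - 3 * xi4 + (vL ^ 5 * qX - xi2 * xi4)"
    unfolding coord_defs folds simps unfolding rX_def qX_def folds by (rule ring_identity_xi4)
  show "dF eta = - eta + (- 4 * xi3 + 2 * xi2 * xi2 - 2 * xi2 * eta - eta * eta
     + 5 * (vL ^ 5 * (2 * (5 * vX) + 5 * vY + 2)))"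
    unfolding coord_defs folds simps unfolding rY_def folds by (rule ring_identity_eta)
qed

text \<open>On the generators this is \<open>dF_coords\<close> and the equation of \<open>L\<close>.
  The operators \<open>dF + w\<close> obey a Leibniz rule in which the weights add, which settles
  products.\<close>

lemma Fil_dF: "Fil w f \<Longrightarrow> Fil (w + 1) (dF f + of_int w * f)"
proof (induction rule: Fil.induct)
  case (const c)
  show ?case by (simp add: dF_const Fil_0)
next
  case L
  have "Fil 6 (vL ^ 6)" using Fil_L_power[of 6] by simp
  moreover have "dF vL + of_int 1 * vL = vL ^ 6"
    by (simp add: dF_vL algebra_simps eval_nat_numeral)
  ultimately show ?case using Fil_mono by simp
next
  case L'
  have "Fil 4 (vL ^ 4)" using Fil_L_power[of 4] by simp
  moreover have "dF vL' + of_int (- 1) * vL' = - (vL * vL') * vL ^ 4"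
    by (simp add: dF_vL' algebra_simps eval_nat_numeral)
  ultimately show ?case using Fil_mono[of 4 "vL ^ 4" 0] by (simp add: vL_vL' Fil_uminus)
next
  case xi2
  have "Fil 2 (xi3 - xi2 * xi2)"
    using Fil.mult[OF Fil.xi2 Fil.xi2] by (intro Fil_diff Fil.xi3) simp
  then show ?case by (simp add: dF_coords)
next
  case xi3
  have "Fil 3 (xi4 - xi2 * xi3)"
    using Fil.mult[OF Fil.xi2 Fil.xi3] by (intro Fil_diff Fil.xi4) simp
  then show ?case by (simp add: dF_coords)
next
  case xi4
  have "Fil 0 qX"
    unfolding qX_def by (intro Fil.add Fil_mult0 Fil_numeral Fil_gens Fil_power)
  from Fil_mult0[OF this Fil_L_power[of 5]] have "Fil 4 (vL ^ 5 * qX)"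
    using Fil_mono[of 5 "vL ^ 5 * qX" 4] by (simp add: mult.commute)
  then have "Fil 4 (vL ^ 5 * qX - xi2 * xi4)"
    using Fil.mult[OF Fil.xi2 Fil.xi4] by (intro Fil_diff) simp_all
  then show ?case by (simp add: dF_coords)
next
  case eta
  have "Fil 0 (2 * (5 * vX) + 5 * vY + 2)"
    by (intro Fil.add Fil_mult0 Fil_numeral Fil_gens)
  from Fil_mult0[OF this Fil_L_power[of 5]] have "Fil 2 (vL ^ 5 * (2 * (5 * vX) + 5 * vY + 2))"
    using Fil_mono[of 5 "vL ^ 5 * (2 * (5 * vX) + 5 * vY + 2)" 2] by (simp add: mult.commute)
  moreover have "Fil 2 (xi2 * xi2)" "Fil 2 (xi2 * eta)" "Fil 2 (eta * eta)"
    using Fil.mult[OF Fil.xi2 Fil.xi2] Fil.mult[OF Fil.xi2 Fil.eta] Fil.mult[OF Fil.eta Fil.eta] by simp_all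
  ultimately have "Fil 2 (- (4 * xi3) + 2 * (xi2 * xi2) - 2 * (xi2 * eta) - eta * eta
     + 5 * (vL ^ 5 * (2 * (5 * vX) + 5 * vY + 2)))"
    using Fil_mult0[OF Fil_numeral] Fil_uminus Fil.xi3 by (intro Fil.add Fil_diff) blast+
  then show ?case by (simp add: dF_coords mult.assoc)
next
  case (add w f g)
  have "dF (f + g) + of_int w * (f + g) = (dF f + of_int w * f) + (dF g + of_int w * g)"
    by (simp add: dF_add algebra_simps)
  then show ?case using add Fil.add by metis
next
  case (mult w f v g)
  have "dF (f * g) + of_int (w + v) * (f * g) = (dF f + of_int w * f) * g + f * (dF g + of_int v * g)"
    by (simp add: dF_mult algebra_simps)
  moreover have "Fil (w + v + 1) ((dF f + of_int w * f) * g)" "Fil (w + v + 1) (f * (dF g + of_int v * g))"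
    using Fil.mult[OF mult(3) mult(2)] Fil.mult[OF mult(1) mult(4)] by (simp_all add: algebra_simps)
  ultimately show ?case using Fil.add by metis
next
  case (mono w f)
  \<comment> \<open>When weight \<open>w + 1\<close> is lowered to \<open>w\<close>, the correction
    \<open>- f\<close> still has weight \<open>w + 1\<close>.\<close>
  have "dF f + of_int w * f = (dF f + of_int (w + 1) * f) - f"
    by (simp add: algebra_simps)
  then show ?case using mono Fil_diff[OF Fil.mono] by metis
qed

lemma Fil_dF0: "Fil 0 f \<Longrightarrow> Fil 1 (dF f)"
  using Fil_dF[of 0 f] by simp

text \<open>On weight \<open>- n < 0\<close>, \<open>dF\<close> is multiplication by
  \<open>n\<close> up to weight \<open>1 - n\<close>. As \<open>dF f\<close> has weight 0,
  \<open>n f\<close> and hence \<open>f\<close> have weight \<open>1 - n\<close>; repeating this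
  raises any initial weight to 0.\<close>

lemma Fil_0_of_dF:
  assumes "Fil 0 (dF f)"
  shows "Fil 0 f"
proof -
  have "Fil 0 f" if "Fil (- int n) f" for n
    using that
  proof (induction n)
    case (Suc n)
    let ?w = "- int (Suc n)"
    have "Fil (?w + 1) (dF f + of_int ?w * f)" by (rule Fil_dF[OF Suc.prems])
    moreover have "Fil (?w + 1) (dF f)" using Fil_mono[OF assms] by simp
    ultimately have "Fil (?w + 1) ((dF f + of_int ?w * f) - dF f)" by (rule Fil_diff)
    then have "Fil (- int n) (of_int ?w * f)" by simp
    from Fil_mult0[OF Fil.const this, of "1 / of_int ?w"]
    have "Fil (- int n) ((cc (1 / of_int ?w) * of_int ?w) * f)" by (simp only: mult.assoc)
    moreover have "cc (1 / of_int ?w) * of_int ?w = cc ((1 / of_int ?w) * of_int ?w)"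
      by (simp only: mult_single single_of_int[symmetric] add_0)
    moreover have "(1 / of_int ?w) * of_int ?w = (1 :: complex)"
    proof -
      have "of_int ?w \<noteq> (0 :: complex)" by (simp only: of_int_eq_0_iff)
      then show ?thesis unfolding times_divide_eq_left mult_1 by (rule divide_self)
    qed
    ultimately have "Fil (- int n) f" by (simp only: single_one mult_1)
    then show ?case by (rule Suc.IH)
  qed simp
  moreover obtain w where "Fil w f" using Fil_exists by blast
  then have "Fil (- int (nat (- w))) f" by (rule Fil_mono) simp
  ultimately show ?thesis by blast
qed

lemma Fil_0_M:
  assumes "Fil 0 f"
  shows "fls_nth (ev_T f) 0 = M (ev_K f)"
  using Fil_lead[OF assms] by (auto simp: M_conv_ev_p[OF inj] lead_def)

end

section \<open>Solutions of the system\<close>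

text \<open>The system (S) multiplied by \<open>m = 5 l\<close>, in terms of \<open>5 * D\<close> or
  \<open>- D\<close>. Free of division, it makes sense in \<open>FF\<close> and passes through
  \<open>ev_K\<close> and \<open>ev_T\<close>.\<close>

definition scaled_system :: "('a::comm_ring_1 \<Rightarrow> 'a) \<Rightarrow> 'a \<Rightarrow> 'a \<Rightarrow> 'a \<Rightarrow> (nat \<Rightarrow> nat \<Rightarrow> 'a) \<Rightarrow> bool" where
  "scaled_system d m A B R \<longleftrightarrow> (\<forall>p.
     m * (R 1 (Suc p) - R 0 (Suc p)) = d (R 0 p) \<and>
     m * (R 2 (Suc p) - R 1 (Suc p)) = A * R 1 p + d (R 1 p) \<and>
     m * (R 3 (Suc p) - R 2 (Suc p)) = B * R 2 p + d (R 2 p) \<and>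
     m * (R 4 (Suc p) - R 3 (Suc p)) = - B * R 3 p + d (R 3 p) \<and>
     m * (R 0 (Suc p) - R 4 (Suc p)) = - A * R 4 p + d (R 4 p))"

lemma scaled_systemD:
  assumes "scaled_system d m A B R"
  shows "m * (R 1 (Suc p) - R 0 (Suc p)) = d (R 0 p)"
    "m * (R 2 (Suc p) - R 1 (Suc p)) = A * R 1 p + d (R 1 p)"
    "m * (R 3 (Suc p) - R 2 (Suc p)) = B * R 2 p + d (R 2 p)"
    "m * (R 4 (Suc p) - R 3 (Suc p)) = - B * R 3 p + d (R 3 p)"
    "m * (R 0 (Suc p) - R 4 (Suc p)) = - A * R 4 p + d (R 4 p)"
  using assms unfolding scaled_system_def by blast+

text \<open>The left sides telescope around the cycle. At level \<open>p + 1\<close> this constrains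
  what the differences leave open.\<close>

lemma scaled_system_sum:
  assumes "scaled_system d m A B R"
  shows "d (R 0 p) + d (R 1 p) + d (R 2 p) + d (R 3 p) + d (R 4 p)
    + A * (R 1 p - R 4 p) + B * (R 2 p - R 3 p) = 0"
proof -
  have "d (R 0 p) + (A * R 1 p + d (R 1 p)) + (B * R 2 p + d (R 2 p)) + (- B * R 3 p + d (R 3 p))
      + (- A * R 4 p + d (R 4 p)) = m * (R 1 (Suc p) - R 0 (Suc p)) + m * (R 2 (Suc p) - R 1 (Suc p))
      + m * (R 3 (Suc p) - R 2 (Suc p)) + m * (R 4 (Suc p) - R 3 (Suc p)) + m * (R 0 (Suc p) - R 4 (Suc p))"
    unfolding scaled_systemD[OF assms] ..
  also have "\<dots> = 0"
    by (simp add: algebra_simps)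
  finally show ?thesis
    by (simp add: algebra_simps)
qed

text \<open>Used with \<open>c = 5\<close>, \<open>l = L_K\<close> and with \<open>c = - 1\<close>,
  \<open>l = l_O\<close>, so that both systems take the same shape.\<close>

lemma scaled_system_of_S:
  assumes S: "system_S L X Y R" and c: "c \<noteq> 0" "D c = 0" and l: "c * L = 5 * l" "l \<noteq> 0" "c * D l = l * (l ^ 5 - 1)"
  shows "scaled_system (\<lambda>f. c * D f) (5 * l) (l ^ 5 - 1 - c * X) (2 * (l ^ 5 - 1) - c * X - c * Y) R"
proof -
  have L: "L = 5 * l / c"
    using c l(1) by (simp add: field_simps)
  have "c * D L = 5 * D l"
    using arg_cong[OF l(1), of D] c by (simp add: D_mult D.d_numeral)
  then have DL: "D L = 5 * D l / c"
    using c by (simp add: field_simps)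
  have e: "5 * l * (D L / L ^ 2) = l ^ 5 - 1"
  proof -
    have "5 * l * (D L / L ^ 2) = c * D l / l"
      unfolding DL unfolding L using c l(2) by (simp add: field_simps power2_eq_square)
    then show ?thesis
      using l by simp
  qed
  have i: "5 * l * (Z / L) = c * Z" for Z
    unfolding L using c l(2) by simp
  have step1: "5 * l * (a - b) = c * D r" if "a = b + D r / L" for a b r
    unfolding that i[symmetric] by simp
  have step: "5 * l * (a - b) = A * r + c * D r"
    if "a = b + A' * r + D r / L" "5 * l * A' = A" for a b r A A'
    unfolding that(1) that(2)[symmetric] i[symmetric] by (simp add: algebra_simps)
  have A: "5 * l * (D L / L ^ 2 - X / L) = l ^ 5 - 1 - c * X"
    "5 * l * (2 * (D L / L ^ 2) - X / L - Y / L) = 2 * (l ^ 5 - 1) - c * X - c * Y"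
    "5 * l * (X / L + Y / L - 2 * (D L / L ^ 2)) = - (2 * (l ^ 5 - 1) - c * X - c * Y)"
    "5 * l * (X / L - D L / L ^ 2) = - (l ^ 5 - 1 - c * X)"
    unfolding e[symmetric] i[symmetric] by (simp_all add: algebra_simps)
  show ?thesis
    unfolding scaled_system_def
  proof (intro allI conjI)
    fix p
    note S' = S[unfolded system_S_def, rule_format, of p, unfolded Suc_eq_plus1[symmetric]]
    show "5 * l * (R 1 (Suc p) - R 0 (Suc p)) = c * D (R 0 p)"
      by (rule step1) (use S' in blast)
    show "5 * l * (R 2 (Suc p) - R 1 (Suc p)) = (l ^ 5 - 1 - c * X) * R 1 p + c * D (R 1 p)"
      by (rule step[OF _ A(1)]) (use S' in blast)
    show "5 * l * (R 3 (Suc p) - R 2 (Suc p)) = (2 * (l ^ 5 - 1) - c * X - c * Y) * R 2 p + c * D (R 2 p)"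
      by (rule step[OF _ A(2)]) (use S' in blast)
    show "5 * l * (R 4 (Suc p) - R 3 (Suc p)) = - (2 * (l ^ 5 - 1) - c * X - c * Y) * R 3 p + c * D (R 3 p)"
      by (rule step[OF _ A(3)]) (use S' in blast)
    show "5 * l * (R 0 (Suc p) - R 4 (Suc p)) = - (l ^ 5 - 1 - c * X) * R 4 p + c * D (R 4 p)"
      by (rule step[OF _ A(4)]) (use S' in blast)
  qed
qed

lemma all_le_4: "(\<forall>j\<le>(4::nat). Q j) \<longleftrightarrow> Q 0 \<and> Q 1 \<and> Q 2 \<and> Q 3 \<and> Q 4"
proof -
  have "j \<le> 4 \<longleftrightarrow> j = 0 \<or> j = 1 \<or> j = 2 \<or> j = 3 \<or> j = 4" for j :: nat by auto
  then show ?thesis by auto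
qed

text \<open>Level \<open>p\<close> fixes the differences of entries at level \<open>p + 1\<close>,
  so two solutions differ there by a common \<open>E\<close>. It cancels from the terms with
  \<open>A\<close> and \<open>B\<close> of the telescoped relation, leaving
  \<open>5 D E = 0\<close>; the constant terms then give \<open>E = 0\<close>.\<close>

lemma scaled_system_unique:
  assumes P: "scaled_system (\<lambda>f. - D f) m A B P" and Q: "scaled_system (\<lambda>f. - D f) m A B Q"
    and m: "m \<noteq> 0" and zero: "\<forall>j\<le>4. P j 0 = Q j 0"
    and const: "\<forall>j\<le>4. \<forall>p. fls_nth (P j p) 0 = fls_nth (Q j p) 0"
  shows "\<forall>j\<le>4. P j p = Q j p"
proof (induction p)
  case 0
  show ?case by (rule zero)
next
  case (Suc p)
  define E where "E = P 0 (Suc p) - Q 0 (Suc p)"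
  have eq: "P 0 p = Q 0 p" "P 1 p = Q 1 p" "P 2 p = Q 2 p" "P 3 p = Q 3 p" "P 4 p = Q 4 p"
    using Suc by auto
  note P' = scaled_systemD[OF P, of p, unfolded eq] and Q' = scaled_systemD[OF Q, of p]
  have cancel: "a - b = a' - b'" if "m * (a - b) = r" "m * (a' - b') = r" for a b a' b' r
    using that m by (metis mult_cancel_left)
  have diffs: "P 1 (Suc p) - P 0 (Suc p) = Q 1 (Suc p) - Q 0 (Suc p)"
    "P 2 (Suc p) - P 1 (Suc p) = Q 2 (Suc p) - Q 1 (Suc p)"
    "P 3 (Suc p) - P 2 (Suc p) = Q 3 (Suc p) - Q 2 (Suc p)"
    "P 4 (Suc p) - P 3 (Suc p) = Q 4 (Suc p) - Q 3 (Suc p)"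
    by (rule cancel[OF P'(1) Q'(1)] cancel[OF P'(2) Q'(2)] cancel[OF P'(3) Q'(3)] cancel[OF P'(4) Q'(4)])+
  have shift: "a = b + E" if "a - a' = b - b'" "a' = b' + E" for a a' b b'
    using that by (simp add: algebra_simps)
  have E0: "P 0 (Suc p) = Q 0 (Suc p) + E"
    by (simp add: E_def)
  note E1 = shift[OF diffs(1) E0]
  note E2 = shift[OF diffs(2) E1]
  note E3 = shift[OF diffs(3) E2]
  note E4 = shift[OF diffs(4) E3]
  note E = E0 E1 E2 E3 E4
  have "5 * D E = 0"
    using scaled_system_sum[OF P, of "Suc p"] scaled_system_sum[OF Q, of "Suc p"]
    unfolding E D_add by algebra
  then have DE: "D E = 0" by simp
  have "E = 0"
  proof (rule fls_eqI)
    fix n :: int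
    have "of_int n * fls_nth E n = 0"
      using arg_cong[OF DE, of "\<lambda>f. fls_nth f n"] by simp
    moreover have "fls_nth E 0 = 0"
      using const by (simp add: E_def)
    ultimately show "fls_nth E n = fls_nth 0 n"
      by (cases "n = 0") auto
  qed
  then show ?case
    using E by (simp add: all_le_4)
qed

context
  assumes inj: "inj ev_K"
begin

text \<open>\<open>A = vL^5 - xi2\<close> and \<open>B = 2 vL^5 - xi2 - eta\<close> have weight 1,
  as does \<open>dF\<close> of an element of weight 0. Division by \<open>5 vL\<close> then gives
  the differences at level \<open>p + 1\<close> weight 0.\<close>

lemma scaled_system_Fil:
  assumes f: "scaled_system dF (5 * vL) (vL ^ 5 - 1 - 5 * vX) (2 * (vL ^ 5 - 1) - 5 * vX - 5 * vY) f"
    and zero: "\<forall>j\<le>4. f j 0 = 1"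
  shows "\<forall>j\<le>4. Fil 0 (f j p)"
proof (induction p)
  case 0
  then show ?case using zero Fil_1 by simp
next
  case (Suc p)
  let ?A = "vL ^ 5 - 1 - 5 * vX" and ?B = "2 * (vL ^ 5 - 1) - 5 * vX - 5 * vY"
  have L: "Fil 1 (vL ^ 5)"
    using Fil_L_power[of 5] Fil_mono by simp
  have A: "Fil 1 ?A"
  proof -
    have "Fil 1 (vL ^ 5 - xi2)" by (intro Fil_diff L Fil.xi2)
    then show ?thesis by (simp add: xi2_def algebra_simps)
  qed
  have B: "Fil 1 ?B"
  proof -
    have "Fil 1 (2 * vL ^ 5 - xi2 - eta)" by (intro Fil_diff Fil_mult0 L Fil.xi2 Fil.eta Fil_numeral)
    moreover have "2 * vL ^ 5 - xi2 - eta = ?B" by (simp add: xi2_def eta_def algebra_simps)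
    ultimately show ?thesis by simp
  qed
  have mult1: "Fil 1 (g * h)" if "Fil 1 g" "Fil 0 h" for g h
    using Fil.mult[OF that] by simp
  have F: "Fil 0 (f j p)" if "j \<le> 4" for j
    using Suc that by blast
  have d: "Fil 1 (dF (f j p))" if "j \<le> 4" for j
    using Fil_dF0[OF inj F[OF that]] .
  define e where "e j = f j (Suc p) - f 0 (Suc p)" for j
  have cancel: "Fil 0 g" if "Fil 1 (5 * vL * g)" for g
  proof -
    have "cc (1/5) * (vL' * (5 * vL * g)) = (5 * cc (1/5)) * (vL * vL') * g"
      by (simp only: mult_ac)
    also have "\<dots> = g"
      unfolding cc_numeral_inverse vL_vL' by simp
    finally show ?thesis
      using Fil_mult0[OF Fil.const Fil.mult[OF Fil.L' that], of "1/5"] by simp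
  qed
  have e1: "Fil 0 (e 1)"
    unfolding e_def by (rule cancel, unfold scaled_systemD(1)[OF f], rule d) simp
  have chain: "Fil 0 (e k)" if "Fil 0 (e j)" "Fil 1 r" "5 * vL * (f k (Suc p) - f j (Suc p)) = r" for j k r
  proof -
    have "Fil 0 (f k (Suc p) - f j (Suc p))"
      by (rule cancel) (simp only: that)
    then have "Fil 0 ((f k (Suc p) - f j (Suc p)) + e j)"
      using that(1) by (rule Fil.add)
    then show ?thesis by (simp add: e_def)
  qed
  note f' = scaled_systemD[OF f, of p]
  have e2: "Fil 0 (e 2)"
    by (rule chain[OF e1 _ f'(2)], intro Fil.add mult1 A F d) simp_all
  have e3: "Fil 0 (e 3)"
    by (rule chain[OF e2 _ f'(3)], intro Fil.add mult1 B F d) simp_all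
  have e4: "Fil 0 (e 4)"
    by (rule chain[OF e3 _ f'(4)], intro Fil.add mult1 Fil_uminus B F d) simp_all
  have fe: "f j (Suc p) = f 0 (Suc p) + e j" for j
    by (simp add: e_def)
  \<comment> \<open>\<open>f 0 (Suc p)\<close> cancels from the factors of \<open>A\<close> and
    \<open>B\<close>, so its derivative has weight 1 and \<open>Fil_0_of_dF\<close> applies.\<close>
  have "5 * dF (f 0 (Suc p)) + (dF (e 1) + dF (e 2) + dF (e 3) + dF (e 4) + ?A * (e 1 - e 4) + ?B * (e 2 - e 3)) = 0"
    using scaled_system_sum[OF f, of "Suc p"] unfolding fe[of 1] fe[of 2] fe[of 3] fe[of 4] dF_add[OF inj]
    by (simp add: algebra_simps)
  then have "5 * dF (f 0 (Suc p)) = - (dF (e 1) + dF (e 2) + dF (e 3) + dF (e 4) + ?A * (e 1 - e 4) + ?B * (e 2 - e 3))"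
    by (rule eq_neg_iff_add_eq_0[THEN iffD2])
  moreover have "Fil 1 (- (dF (e 1) + dF (e 2) + dF (e 3) + dF (e 4) + ?A * (e 1 - e 4) + ?B * (e 2 - e 3)))"
    by (intro Fil_uminus Fil.add Fil_dF0[OF inj] mult1 A B Fil_diff e1 e2 e3 e4)
  ultimately have "Fil 1 (5 * dF (f 0 (Suc p)))" by simp
  then have "Fil 1 (cc (1/5) * (5 * dF (f 0 (Suc p))))"
    by (rule Fil_mult0[OF Fil.const])
  also have "cc (1/5) * (5 * dF (f 0 (Suc p))) = (5 * cc (1/5)) * dF (f 0 (Suc p))"
    by (simp only: mult_ac)
  finally have "Fil 1 (dF (f 0 (Suc p)))"
    unfolding cc_numeral_inverse by simp
  then have "Fil 0 (f 0 (Suc p))"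
    using Fil_0_of_dF[OF inj] Fil_mono by simp
  then show ?case
    unfolding all_le_4 fe[of 1] fe[of 2] fe[of 3] fe[of 4] using e1 e2 e3 e4 by (blast intro: Fil.add)
qed

end

section \<open>Multiplication by the exponential factor\<close>

definition conv :: "complex fps \<Rightarrow> (nat \<Rightarrow> complex fls) \<Rightarrow> nat \<Rightarrow> complex fls" where
  "conv e a p = (\<Sum>k\<le>p. fls_const (fps_nth e k) * a (p - k))"

lemma conv_diff_Suc:
  assumes "a 0 = b 0"
  shows "conv e a (Suc p) - conv e b (Suc p) = conv e (\<lambda>n. a (Suc n) - b (Suc n)) p"
  using assms by (simp add: conv_def Suc_diff_le sum_subtractf right_diff_distrib)

text \<open>The system is linear and \<open>D\<close> kills the coefficients of \<open>e\<close>.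
  The initial values agree, so the extra summand in the shift from \<open>p\<close> to
  \<open>p + 1\<close> cancels from the differences.\<close>

lemma scaled_system_conv:
  assumes R: "scaled_system (\<lambda>f. - D f) m A B R" and zero: "\<forall>j\<le>4. R j 0 = 1"
  shows "scaled_system (\<lambda>f. - D f) m A B (\<lambda>j. conv e (R j))"
proof -
  have scale: "m * conv e a p = conv e (\<lambda>n. m * a n) p" for m a p
    by (simp add: conv_def sum_distrib_left mult_ac)
  have D: "- D (conv e a p) = conv e (\<lambda>n. - D (a n)) p" for a p
  proof -
    have "D (conv e a p) = (\<Sum>k\<le>p. D (fls_const (fps_nth e k) * a (p - k)))"
      unfolding conv_def by (induction "{..p}" rule: infinite_finite_induct)
        (simp_all add: D_def fls_deriv_sum sum_distrib_left)
    then show ?thesis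
      by (simp add: conv_def D_scale sum_negf)
  qed
  have add: "conv e a p + conv e b p = conv e (\<lambda>n. a n + b n) p" for a b p
    by (simp add: conv_def sum.distrib distrib_left)
  note R' = scaled_systemD[OF R]
  have z: "R 0 0 = 1" "R 1 0 = 1" "R 2 0 = 1" "R 3 0 = 1" "R 4 0 = 1"
    using zero by auto
  show ?thesis
    unfolding scaled_system_def
    by (intro allI conjI; subst conv_diff_Suc; (simp only: z)?; unfold scale D add; intro arg_cong2[where f = "conv e"] refl ext; rule R')
qed

lemma rescale_nth: "fps_nth (rescale i A) n = fls_const ((1 / zeta ^ i) ^ n) * fps_nth A n"
  by (simp add: rescale_def fls_const_power)

lemma Rmat_K_nth:
  "fps_nth (Rmat_K R i j) p = fls_const ((1 / zeta ^ i) ^ p) * conv exp_K (\<lambda>n. fps_to_fls (R j n)) p"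
proof -
  have "Rmat_K R i j = rescale i (coeffwise fls_const exp_K * Abs_fps (\<lambda>n. fps_to_fls (R j n)))"
    unfolding Rmat_K_def rescale_def by (rule fps_compose_mult_distrib[symmetric]) simp
  then show ?thesis
    by (simp add: rescale_nth fps_mult_nth conv_def atMost_atLeast0)
qed

lemma exp_K_0: "fps_nth exp_K 0 = 1"
  by (simp add: exp_K_def)

theorem proposition11:
  fixes R P :: "nat \<Rightarrow> nat \<Rightarrow> complex fps"
  assumes polynomial_ring: "inj ev_K"
    and R: "R_solution_K R"
    and R_in_ring: "\<forall>j\<le>4. \<forall>p. fps_to_fls (R j p) \<in> ring_K"
    and P: "R_solution_O P"
  shows "(\<forall>i\<le>4. \<forall>j\<le>4. coeffwise T (Rmat_K R i j) = Rmat_O P i j) \<longleftrightarrow>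
         (\<forall>i\<le>4. exp_K * Abs_fps (\<lambda>k. a_num R i k) = exp_O i)"
proof -
  note inj = polynomial_ring
  let ?A = "l_O ^ 5 - 1 - (- X_O)" and ?B = "2 * (l_O ^ 5 - 1) - (- X_O) - (- Y_O)"
  define f where "f j p = inv ev_K (fps_to_fls (R j p))" for j p
  have f: "ev_K (f j p) = fps_to_fls (R j p)" if "j \<le> 4" for j p
    unfolding f_def using R_in_ring that by (intro f_inv_into_f) (auto simp: ring_K_def)
  have fs: "ev_K (f 0 p) = fps_to_fls (R 0 p)" "ev_K (f 1 p) = fps_to_fls (R 1 p)"
    "ev_K (f 2 p) = fps_to_fls (R 2 p)" "ev_K (f 3 p) = fps_to_fls (R 3 p)"
    "ev_K (f 4 p) = fps_to_fls (R 4 p)" for p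
    by (simp_all add: f)
  have f0: "\<forall>j\<le>4. f j 0 = 1"
  proof (intro allI impI)
    fix j :: nat assume j: "j \<le> 4"
    have "ev_K (f j 0) = ev_K 1"
      using R j unfolding f[OF j] ev_K_hom by (simp add: R_solution_K_def)
    then show "f j 0 = 1"
      using inj by (simp add: inj_eq)
  qed
  have "scaled_system (\<lambda>f. 5 * D f) (5 * L_K) (L_K ^ 5 - 1 - 5 * X_K)
      (2 * (L_K ^ 5 - 1) - 5 * X_K - 5 * Y_K) (\<lambda>j p. fps_to_fls (R j p))"
    using R L_K_props by (intro scaled_system_of_S) (auto simp: R_solution_K_def D.d_numeral)
  note R' = scaled_systemD[OF this]
  \<comment> \<open>Injectivity of \<open>ev_K\<close> lifts the system from series to
    polynomials.\<close>
  have sys_f: "scaled_system dF (5 * vL) (vL ^ 5 - 1 - 5 * vX) (2 * (vL ^ 5 - 1) - 5 * vX - 5 * vY) f"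
    unfolding scaled_system_def
    by (intro allI conjI; rule injD[OF inj]; simp only: ev_K_hom ev_K_dF[OF inj] fs R')
  have Fil: "Fil 0 (f j p)" if "j \<le> 4" for j p
    using scaled_system_Fil[OF inj sys_f f0] that by blast
  \<comment> \<open>\<open>Q j p\<close> is \<open>T\<close> applied to
    \<open>R j p\<close>.\<close>
  define Q where "Q j p = ev_T (f j p)" for j p
  have Q0: "\<forall>j\<le>4. Q j 0 = 1"
    using f0 by (simp add: Q_def ev_T_hom)
  have a: "fls_nth (Q j p) 0 = a_num R j p" if "j \<le> 4" for j p
    using Fil_0_M[OF inj Fil[OF that]] f[OF that] by (simp add: Q_def a_num_def)
  have five: "5 * (- X / 5) = - (X :: complex fls)" for X
    by simp
  have sys_Q: "scaled_system (\<lambda>f. - D f) (5 * l_O) ?A ?B Q"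
    unfolding scaled_system_def Q_def
    using arg_cong[OF scaled_systemD(1)[OF sys_f], of ev_T] arg_cong[OF scaled_systemD(2)[OF sys_f], of ev_T]
      arg_cong[OF scaled_systemD(3)[OF sys_f], of ev_T] arg_cong[OF scaled_systemD(4)[OF sys_f], of ev_T]
      arg_cong[OF scaled_systemD(5)[OF sys_f], of ev_T]
    unfolding ev_T_hom ev_T_dF[OF inj] five by blast
  have sys_P: "scaled_system (\<lambda>f. - D f) (5 * l_O) ?A ?B (\<lambda>j p. fps_to_fls (P j p))"
    using scaled_system_of_S[of L_O X_O Y_O "\<lambda>j p. fps_to_fls (P j p)" "- 1" l_O] P l_O_props(1,4)
    by (simp add: R_solution_O_def D.d_uminus D.d_1 l_O_def)
  have P0: "\<forall>j\<le>4. P j 0 = 1" and Pc: "\<And>j p. j \<le> 4 \<Longrightarrow> fps_nth (P j p) 0 = fps_nth (exp_O j) p"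
  proof -
    show "\<forall>j\<le>4. P j 0 = 1"
      using P by (simp add: R_solution_O_def)
    fix j p :: nat assume "j \<le> 4"
    then have "Abs_fps (\<lambda>p. fps_nth (P j p) 0) = exp_O j"
      using P by (simp add: R_solution_O_def)
    then show "fps_nth (P j p) 0 = fps_nth (exp_O j) p"
      by (metis fps_nth_Abs_fps)
  qed
  have conv_const: "fls_nth (conv exp_K (Q j) p) 0 = fps_nth (exp_K * Abs_fps (a_num R j)) p"
    if "j \<le> 4" for j p
    by (simp add: conv_def fls_nth_sum fps_mult_nth a[OF that] atMost_atLeast0)
  \<comment> \<open>Since \<open>T\<close> passes through \<open>inv ev_K\<close>, a representative
    \<open>h\<close> of the argument is needed before the homomorphism rules of \<open>ev_T\<close>
    apply.\<close>
  have T: "T (c * conv exp_K (\<lambda>n. fps_to_fls (R j n)) p) = c * conv exp_K (Q j) p"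
    if "j \<le> 4" "c = fls_const c'" for c c' j p
  proof -
    define h where "h = cc c' * (\<Sum>k\<le>p. cc (fps_nth exp_K k) * f j (p - k))"
    have sum: "ev_K (sum g S) = (\<Sum>x\<in>S. ev_K (g x))" "ev_T (sum g S) = (\<Sum>x\<in>S. ev_T (g x))"
      for g and S :: "nat set"
      by (induction S rule: infinite_finite_induct) (simp_all add: ev_K_hom ev_T_hom)
    have K: "ev_K h = c * conv exp_K (\<lambda>n. fps_to_fls (R j n)) p"
      by (simp add: h_def conv_def sum ev_K_hom f that)
    have "T (ev_K h) = ev_T h"
      using inj by (simp add: T_def ev_O_T_FF)
    also have "ev_T h = c * conv exp_K (Q j) p"
      by (simp add: h_def conv_def sum ev_T_hom Q_def that)
    finally show ?thesis
      unfolding K .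
  qed
  have zeta: "zeta \<noteq> 0"
    by (simp add: zeta_def)
  have "(\<forall>i\<le>4. \<forall>j\<le>4. coeffwise T (Rmat_K R i j) = Rmat_O P i j) \<longleftrightarrow>
      (\<forall>j\<le>4. \<forall>p. conv exp_K (Q j) p = fps_to_fls (P j p))"
  proof -
    \<comment> \<open>The factors \<open>(1 / zeta^i)^p\<close> are nonzero constants and cancel, so
      the condition does not depend on \<open>i\<close>.\<close>
    have "coeffwise T (Rmat_K R i j) = Rmat_O P i j \<longleftrightarrow>
        (\<forall>p. conv exp_K (Q j) p = fps_to_fls (P j p))" if "j \<le> 4" for i j
      using zeta by (simp add: fps_eq_iff Rmat_K_nth T[OF that refl] Rmat_O_def rescale_nth)
    then show ?thesis by blast
  qed
  \<comment> \<open>Both families solve the orbifold system with first terms 1, so it suffices to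
    compare them at \<open>\<psi> = 0\<close>, where \<open>Q\<close> is given by
    \<open>a_num\<close> and \<open>P\<close> by \<open>exp_O\<close>.\<close>
  also have "\<dots> \<longleftrightarrow> (\<forall>j\<le>4. \<forall>p. fls_nth (conv exp_K (Q j) p) 0 = fps_nth (P j p) 0)"
  proof (intro iffI allI impI)
    fix j p :: nat
    assume const: "\<forall>j\<le>4. \<forall>p. fls_nth (conv exp_K (Q j) p) 0 = fps_nth (P j p) 0" and j: "j \<le> 4"
    have "\<forall>j\<le>4. conv exp_K (Q j) p = fps_to_fls (P j p)"
    proof (rule scaled_system_unique[OF scaled_system_conv[OF sys_Q Q0] sys_P])
      show "5 * l_O \<noteq> 0" using l_O_props(4) by simp
      show "\<forall>j\<le>4. conv exp_K (Q j) 0 = fps_to_fls (P j 0)"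
        using Q0 P0 by (simp add: conv_def exp_K_0)
    qed (use const in simp)
    then show "conv exp_K (Q j) p = fps_to_fls (P j p)"
      using j by blast
  qed auto
  also have "\<dots> \<longleftrightarrow> (\<forall>i\<le>4. exp_K * Abs_fps (\<lambda>k. a_num R i k) = exp_O i)"
    by (simp add: fps_eq_iff conv_const Pc)
  finally show ?thesis .
qed

end
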